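(* Let $n,q$ be positive integers with $n$ even, $n\ge8$, $q\ge2$. Any $7$-design $C$ in $H(n,q)$ with degree $4$ and degree set $\{a,n/2,n-a,n\}$ for some integer $a$ with $a<n/2$ is isomorphic either to the dual of the binary repetition code of length $8$ (the set of all binary vectors of length $8$ of even weight) or to the extended binary Golay code of length $24$.
   Context: $[q]=\{1,\ldots,q\}$; $\partial$ is Hamming distance. A nonempty $C\subseteq[q]^n$ is a $t$-design in the Hamming scheme $H(n,q)$ if the array of its elements (as rows) is an orthogonal array of strength $t$: in any $t$ columns every element of $[q]^t$ occurs equally often. Its degree set is $\{\partial(x,y):x,y\in C,x\ne y\}$ and its degree is the size of that set. Two codes are isomorphic if one is obtained from the other by permuting coordinates and permuting symbols within each coordinate. *)

theory Defs
  imports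
    "HOL-Library.FuncSet"
    "HOL-Library.Z2"
    "HOL-Combinatorics.Permutations"
    "HOL-Computational_Algebra.Polynomial"
begin

definition words :: "nat \<Rightarrow> nat \<Rightarrow> (nat \<Rightarrow> nat) set"
  where "words n q = {1..n} \<rightarrow>\<^sub>E {1..q}"

definition hamming_dist :: "nat \<Rightarrow> (nat \<Rightarrow> nat) \<Rightarrow> (nat \<Rightarrow> nat) \<Rightarrow> nat"
  where "hamming_dist n x y = card {i \<in> {1..n}. x i \<noteq> y i}"

definition hamming_design :: "nat \<Rightarrow> nat \<Rightarrow> nat \<Rightarrow> (nat \<Rightarrow> nat) set \<Rightarrow> bool"
  where "hamming_design t n q C \<longleftrightarrow>
    C \<noteq> {} \<and> C \<subseteq> words n q \<and>
    (\<forall>T. T \<subseteq> {1..n} \<and> card T = t \<longrightarrow>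
      (\<exists>l. \<forall>u \<in> T \<rightarrow>\<^sub>E {1..q}. card {x \<in> C. restrict x T = u} = l))"

definition degree_set :: "nat \<Rightarrow> (nat \<Rightarrow> nat) set \<Rightarrow> nat set"
  where "degree_set n C = {hamming_dist n x y | x y. x \<in> C \<and> y \<in> C \<and> x \<noteq> y}"

definition code_degree :: "nat \<Rightarrow> (nat \<Rightarrow> nat) set \<Rightarrow> nat"
  where "code_degree n C = card (degree_set n C)"

definition code_isomorphic :: "nat \<Rightarrow> nat \<Rightarrow> (nat \<Rightarrow> nat) set \<Rightarrow> (nat \<Rightarrow> nat) set \<Rightarrow> bool"
  where "code_isomorphic n q C D \<longleftrightarrow>
    (\<exists>\<pi> \<sigma>. \<pi> permutes {1..n} \<and> (\<forall>i \<in> {1..n}. \<sigma> i permutes {1..q}) \<and>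
      D = (\<lambda>x. \<lambda>i \<in> {1..n}. \<sigma> i (x (\<pi> i))) ` C)"

definition binary_vectors :: "nat \<Rightarrow> (nat \<Rightarrow> bit) set"
  where "binary_vectors n = {1..n} \<rightarrow>\<^sub>E UNIV"

text \<open>Binary codes live over the field with two elements; the alphabet of \<^term>\<open>words n 2\<close> is
  \<open>{1, 2}\<close>, so the bits 0 and 1 are encoded as the symbols 1 and 2.\<close>

definition of_binary :: "nat \<Rightarrow> (nat \<Rightarrow> bit) set \<Rightarrow> (nat \<Rightarrow> nat) set"
  where "of_binary n B = (\<lambda>x. \<lambda>i \<in> {1..n}. if x i = 0 then 1 else 2) ` B"

definition binary_dual :: "nat \<Rightarrow> (nat \<Rightarrow> bit) set \<Rightarrow> (nat \<Rightarrow> bit) set"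
  where "binary_dual n B = {x \<in> binary_vectors n. \<forall>y \<in> B. (\<Sum>i = 1..n. x i * y i) = 0}"

definition binary_repetition :: "nat \<Rightarrow> (nat \<Rightarrow> bit) set"
  where "binary_repetition n = {\<lambda>i \<in> {1..n}. b | b. True}"

lemma binary_dual_repetition_eq_even_weight:
  "binary_dual n (binary_repetition n) =
    {x \<in> binary_vectors n. even (card {i \<in> {1..n}. x i = 1})}"
proof -
  have weight: "(\<Sum>i = 1..n. x i) = of_nat (card {i \<in> {1..n}. x i = 1})" for x :: "nat \<Rightarrow> bit"
  proof -
    have "(\<Sum>i = 1..n. x i) = (\<Sum>i \<in> {i \<in> {1..n}. x i = 1}. x i)"
      by (rule sum.mono_neutral_right) auto
    also have "\<dots> = (\<Sum>i \<in> {i \<in> {1..n}. x i = 1}. 1)"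
      by (rule sum.cong) auto
    finally show ?thesis
      by simp
  qed
  have parity: "(of_nat k :: bit) = 0 \<longleftrightarrow> even k" for k
    by (induction k) auto
  have inner: "(\<Sum>i = 1..n. x i * (\<lambda>j \<in> {1..n}. b) i) = b * (\<Sum>i = 1..n. x i)"
    for x :: "nat \<Rightarrow> bit" and b
    unfolding sum_distrib_left by (rule sum.cong) auto
  have "(\<forall>y \<in> binary_repetition n. (\<Sum>i = 1..n. x i * y i) = 0) \<longleftrightarrow> (\<Sum>i = 1..n. x i) = 0"
    for x :: "nat \<Rightarrow> bit"
  proof
    assume "\<forall>y \<in> binary_repetition n. (\<Sum>i = 1..n. x i * y i) = 0"
    then have "(\<Sum>i = 1..n. x i * (\<lambda>j \<in> {1..n}. 1) i) = 0"
      unfolding binary_repetition_def by blast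
    then show "(\<Sum>i = 1..n. x i) = 0"
      unfolding inner by (simp only: mult_1_left)
  next
    assume zero: "(\<Sum>i = 1..n. x i) = 0"
    show "\<forall>y \<in> binary_repetition n. (\<Sum>i = 1..n. x i * y i) = 0"
    proof
      fix y assume "y \<in> binary_repetition n"
      then obtain b where y: "y = (\<lambda>i \<in> {1..n}. b)"
        unfolding binary_repetition_def by blast
      show "(\<Sum>i = 1..n. x i * y i) = 0"
        unfolding y inner zero by (rule mult_zero_right)
    qed
  qed
  then show ?thesis
    unfolding binary_dual_def by (simp only: weight parity)
qed

text \<open>The binary Golay code of length 23 is the cyclic code with generator polynomial
  \<open>1 + X^2 + X^4 + X^5 + X^6 + X^10 + X^11\<close>, a divisor of \<open>X^23 - 1\<close>, where coordinate \<open>i\<close> carries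
  the coefficient of \<open>X^(i - 1)\<close>. Coordinate 24 is the overall parity check.\<close>

definition golay_generator :: "bit poly"
  where "golay_generator = [:1, 0, 1, 0, 1, 1, 1, 0, 0, 0, 1, 1:]"

definition extended_golay :: "(nat \<Rightarrow> bit) set"
  where "extended_golay =
    {x \<in> binary_vectors 24.
      golay_generator dvd (\<Sum>i = 1..23. monom (x i) (i - 1)) \<and> (\<Sum>i = 1..24. x i) = 0}"

end

theory Submission
  imports Defs
begin

text \<open>Fix a codeword \<open>x\<close> and let \<open>z\<close> count agreements with \<open>x\<close>. Strength 7 makes the first seven
  factorial moments of \<open>z\<close> over the code binomial, while \<open>z\<close> takes only the values given by the degree
  set. Hence \<open>(z - a)(z - n/2)(z - (n - a))\<close> must be the Krawtchouk polynomial of degree 3 for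
  \<open>n - 2\<close> coordinates; its symmetry forces \<open>q = 2\<close>, and its zeros give \<open>(n - 2 a)\<^sup>2 = 3 n - 8\<close>. That
  the number of words at distance \<open>a\<close> is an integer then forces \<open>(n - 2 a)\<^sup>2\<close> to divide 640, which
  leaves \<open>n = 8\<close> and \<open>n = 24\<close>.

  For \<open>n = 8\<close> all distances are even and the code is as large as possible. For \<open>n = 24\<close> the words,
  as subsets of the coordinates, meet pairwise evenly, so by Parseval the code equals its dual. A
  dodecad and its complement split the coordinates, and the words meeting the complement in a pair
  through a fixed point give a biplane on 11 points. The biplane is unique, which identifies the code
  with the Golay code.\<close>

section \<open>Moments of designs\<close>

text \<open>The polynomial \<open>z (n - z) (z - a) (z - n/2) (z - (n - a))\<close> vanishes at
  every agreement number, including \<open>z = n\<close> for \<open>x\<close> itself, and has degree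
  5. Strength 7 thus leaves room for one quadratic test factor: under the weight
  \<open>z (n - z)\<close> the cubic is orthogonal to every quadratic. Testing it against a suitable
  quadratic isolates the factor \<open>1 - 2 p\<close> with \<open>p = 1 / q\<close>.

  Two obstacles shape the case \<open>n = 24\<close>: the code is not assumed to be linear, and the
  target is one concrete cyclic code. Counting settles both. A code of size 4096 inside its own dual
  must equal it because \<open>4096^2 = 2^24\<close>, which yields closure under sums. And since the
  sizes match, an isomorphism needs only an inclusion: after relabelling, the dodecad and eleven
  octads, which generate the code, are checked to be multiples of the generator polynomial.\<close>

definition equidistributed :: "nat \<Rightarrow> (nat \<Rightarrow> nat) set \<Rightarrow> nat set \<Rightarrow> nat \<Rightarrow> bool"
  where "equidistributed q C T l \<longleftrightarrow>
    (\<forall>u \<in> T \<rightarrow>\<^sub>E {1..q}. card {y \<in> C. restrict y T = u} = l)"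

lemma finite_words: "finite (words n q)"
  unfolding words_def by (intro finite_PiE) auto

lemma equidistributed_remove:
  assumes C: "C \<subseteq> words n q" and T: "insert j T \<subseteq> {1..n}" and j: "j \<notin> T"
    and eq: "equidistributed q C (insert j T) l"
  shows "equidistributed q C T (q * l)"
  unfolding equidistributed_def
proof
  fix u assume u: "u \<in> T \<rightarrow>\<^sub>E {1..q}"
  let ?A = "\<lambda>s. {y \<in> C. restrict y (insert j T) = u(j := s)}"
  have fin: "finite C"
    using C finite_words finite_subset by blast
  have split: "{y \<in> C. restrict y T = u} = (\<Union>s\<in>{1..q}. ?A s)"
  proof (intro equalityI subsetI)
    fix y assume y: "y \<in> {y \<in> C. restrict y T = u}"
    then have "y \<in> words n q"
      using C by auto
    then have "y j \<in> {1..q}"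
      using T unfolding words_def by (metis PiE_mem insert_subset)
    moreover have "restrict y (insert j T) = u(j := y j)"
      using y j by (auto simp: fun_eq_iff restrict_def)
    ultimately show "y \<in> (\<Union>s\<in>{1..q}. ?A s)"
      using y by auto
  next
    fix y assume "y \<in> (\<Union>s\<in>{1..q}. ?A s)"
    then obtain s where s: "y \<in> C" "restrict y (insert j T) = u(j := s)"
      by auto
    have "restrict y T = u"
    proof
      fix i show "restrict y T i = u i"
        using fun_cong[OF s(2), of i] u j by (auto simp: restrict_def PiE_def extensional_def split: if_splits)
    qed
    then show "y \<in> {y \<in> C. restrict y T = u}"
      using s by simp
  qed
  have "card (\<Union>s\<in>{1..q}. ?A s) = (\<Sum>s\<in>{1..q}. card (?A s))"
  proof (rule card_UN_disjoint)
    show "\<forall>s\<in>{1..q}. \<forall>t\<in>{1..q}. s \<noteq> t \<longrightarrow> ?A s \<inter> ?A t = {}"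
      by (auto dest: fun_cong[where x = j])
  qed (use fin in auto)
  also have "\<dots> = (\<Sum>s\<in>{1..q}. l)"
  proof (rule sum.cong)
    fix s assume "s \<in> {1..q}"
    then have "u(j := s) \<in> insert j T \<rightarrow>\<^sub>E {1..q}"
      using u by (auto simp: PiE_def extensional_def Pi_def)
    then show "card (?A s) = l"
      using eq unfolding equidistributed_def by blast
  qed simp
  finally show "card {y \<in> C. restrict y T = u} = q * l"
    unfolding split by simp
qed

lemma equidistributed_Diff:
  assumes C: "C \<subseteq> words n q" and D: "finite D" "T \<inter> D = {}" "T \<union> D \<subseteq> {1..n}"
    and eq: "equidistributed q C (T \<union> D) l"
  shows "equidistributed q C T (q ^ card D * l)"
  using D eq
proof (induction D arbitrary: l rule: finite_induct)
  case (insert j D)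
  have "equidistributed q C (T \<union> D) (q * l)"
    by (rule equidistributed_remove[OF C, where j = j]) (use insert.hyps insert.prems in auto)
  then have "equidistributed q C T (q ^ card D * (q * l))"
    using insert by simp
  then show ?case
    using insert.hyps by (simp add: ac_simps)
qed simp

lemma agreement_count:
  assumes C: "hamming_design t n q C" and t: "t \<le> n" and x: "x \<in> C"
    and T: "T \<subseteq> {1..n}" "card T \<le> t"
  shows "card {y \<in> C. \<forall>i\<in>T. y i = x i} * q ^ card T = card C"
proof -
  have sub: "C \<subseteq> words n q"
    using C unfolding hamming_design_def by blast
  have finT: "finite T"
    using T finite_subset by blast
  have "t - card T \<le> card ({1..n} - T)"
    using T t finT by (simp add: card_Diff_subset)
  then obtain D where D: "D \<subseteq> {1..n} - T" "card D = t - card T" "finite D"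
    using obtain_subset_with_card_n by metis
  have "card (T \<union> D) = t"
    using D finT T by (subst card_Un_disjoint) auto
  moreover have TD: "T \<union> D \<subseteq> {1..n}"
    using T D by auto
  ultimately obtain l where l: "equidistributed q C (T \<union> D) l"
    using C unfolding hamming_design_def equidistributed_def by blast
  have "equidistributed q C T (q ^ card D * l)"
    by (rule equidistributed_Diff[OF sub _ _ TD l]) (use D in auto)
  moreover have "restrict x T \<in> T \<rightarrow>\<^sub>E {1..q}"
    using x sub T unfolding words_def by auto
  ultimately have "card {y \<in> C. restrict y T = restrict x T} = q ^ card D * l"
    unfolding equidistributed_def by blast
  moreover have "{y \<in> C. restrict y T = restrict x T} = {y \<in> C. \<forall>i\<in>T. y i = x i}"
    unfolding fun_eq_iff restrict_def by meson
  ultimately have 1: "card {y \<in> C. \<forall>i\<in>T. y i = x i} = q ^ card D * l"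
    by simp
  \<comment> \<open>The empty pattern is met by all of \<open>C\<close>, so the same removal
    argument expresses \<open>card C\<close> through \<open>l\<close>.\<close>
  have "equidistributed q C {} (q ^ card (T \<union> D) * l)"
    by (rule equidistributed_Diff[OF sub]) (use finT D TD l in auto)
  then have "card C = q ^ card (T \<union> D) * l"
    unfolding equidistributed_def by (simp add: restrict_def)
  moreover have "card (T \<union> D) = card T + card D"
    using D finT by (intro card_Un_disjoint) auto
  ultimately show ?thesis
    unfolding 1 by (simp add: power_add)
qed

section \<open>Factorial moments of the agreement numbers\<close>

definition agreements :: "nat \<Rightarrow> (nat \<Rightarrow> nat) \<Rightarrow> (nat \<Rightarrow> nat) \<Rightarrow> nat"
  where "agreements n x y = card {i \<in> {1..n}. y i = x i}"

lemma agreements_add_hamming_dist: "agreements n x y + hamming_dist n x y = n"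
proof -
  have "card ({i \<in> {1..n}. y i = x i} \<union> {i \<in> {1..n}. x i \<noteq> y i}) = agreements n x y + hamming_dist n x y"
    unfolding agreements_def hamming_dist_def by (rule card_Un_disjoint) auto
  moreover have "{i \<in> {1..n}. y i = x i} \<union> {i \<in> {1..n}. x i \<noteq> y i} = {1..n}"
    by auto
  ultimately show ?thesis
    by simp
qed

text \<open>Double counting of the pairs of a word \<open>y\<close> and a \<open>k\<close>-set
  \<open>T\<close> of coordinates on which \<open>y\<close> agrees with \<open>x\<close>.\<close>

lemma sum_agreements_choose:
  assumes C: "hamming_design t n q C" and t: "t \<le> n" and x: "x \<in> C" and k: "k \<le> t"
  shows "(\<Sum>y\<in>C. agreements n x y choose k) * q ^ k = (n choose k) * card C"
proof -
  have fin: "finite C"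
    using C finite_words finite_subset unfolding hamming_design_def by blast
  let ?P = "{T. T \<subseteq> {1..n} \<and> card T = k}"
  have "(\<Sum>y\<in>C. agreements n x y choose k)
      = (\<Sum>y\<in>C. \<Sum>T | T \<in> ?P \<and> (\<forall>i\<in>T. y i = x i). 1)"
  proof (rule sum.cong)
    fix y assume "y \<in> C"
    have "{T. T \<in> ?P \<and> (\<forall>i\<in>T. y i = x i)} = {T. T \<subseteq> {i \<in> {1..n}. y i = x i} \<and> card T = k}"
      by auto
    then show "agreements n x y choose k = (\<Sum>T | T \<in> ?P \<and> (\<forall>i\<in>T. y i = x i). 1)"
      unfolding agreements_def by (simp add: n_subsets)
  qed simp
  also have "\<dots> = (\<Sum>T\<in>?P. \<Sum>y | y \<in> C \<and> (\<forall>i\<in>T. y i = x i). 1)"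
    by (rule sum.swap_restrict) (use fin in auto)
  finally have "(\<Sum>y\<in>C. agreements n x y choose k) * q ^ k
      = (\<Sum>T\<in>?P. card {y \<in> C. \<forall>i\<in>T. y i = x i} * q ^ card T)"
    by (simp add: sum_distrib_right)
  also have "\<dots> = (\<Sum>T\<in>?P. card C)"
    by (rule sum.cong) (use agreement_count[OF C t x] k in auto)
  also have "\<dots> = (n choose k) * card C"
    by (simp add: n_subsets)
  finally show ?thesis .
qed

text \<open>The falling factorial, over the reals so that it can be shifted to \<open>z - 1\<close>
  and \<open>n - 2\<close> without truncated subtraction.\<close>

definition ffact :: "real \<Rightarrow> nat \<Rightarrow> real"
  where "ffact z k = (\<Prod>i<k. z - real i)"

lemma ffact_of_nat: "ffact (real m) k = fact k * real (m choose k)"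
  unfolding ffact_def by (simp add: binomial_gbinomial gbinomial_prod_rev atLeast0LessThan)

lemma sum_ffact_agreements:
  assumes C: "hamming_design t n q C" and t: "t \<le> n" and x: "x \<in> C" and k: "k \<le> t" and q: "q > 0"
  shows "(\<Sum>y\<in>C. ffact (agreements n x y) k) = ffact n k * real (card C) / real q ^ k"
proof -
  have "(\<Sum>y\<in>C. ffact (agreements n x y) k) * real q ^ k
      = fact k * real ((\<Sum>y\<in>C. agreements n x y choose k) * q ^ k)"
    by (simp add: ffact_of_nat sum_distrib_left sum_distrib_right mult.assoc)
  also have "\<dots> = ffact n k * real (card C)"
    unfolding sum_agreements_choose[OF C t x k] by (simp add: ffact_of_nat)
  finally show ?thesis
    using q by (simp add: field_simps)
qed

lemma ffact_0 [simp]: "ffact z 0 = 1"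
  and ffact_Suc: "ffact z (Suc k) = ffact z k * (z - real k)"
  unfolding ffact_def by simp_all

lemma ffact_Suc_shift: "ffact z (Suc k) = z * ffact (z - 1) k"
  by (induction k) (simp_all add: ffact_Suc)

lemmas ffact_numerals = ffact_Suc numeral_eq_Suc

text \<open>The factor \<open>z\<close> raises the falling factorial of \<open>z - 1\<close> to
  order \<open>k + 1\<close>, and writing \<open>n - z\<close> as
  \<open>(n - k - 1) - (z - (k + 1))\<close> leaves only the moments of orders \<open>k + 1\<close>
  and \<open>k + 2\<close>.\<close>

lemma weighted_ffact_sum:
  fixes n N p :: real and z :: "'a \<Rightarrow> real"
  assumes moments: "\<And>k. k \<le> t \<Longrightarrow> (\<Sum>y\<in>C. ffact (z y) k) = ffact n k * N * p ^ k"
    and k: "k + 2 \<le> t"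
  shows "(\<Sum>y\<in>C. z y * (n - z y) * ffact (z y - 1) k)
    = n * (n - 1) * N * p * (1 - p) * (ffact (n - 2) k * p ^ k)"
proof -
  have n: "ffact n (k + 2) = n * (n - 1) * ffact (n - 2) k"
    "ffact n (k + 1) * (n - real k - 1) = n * (n - 1) * ffact (n - 2) k"
  proof -
    show *: "ffact n (k + 2) = n * (n - 1) * ffact (n - 2) k"
      by (simp add: ffact_Suc_shift)
    show "ffact n (k + 1) * (n - real k - 1) = n * (n - 1) * ffact (n - 2) k"
      unfolding *[symmetric] by (simp add: ffact_Suc algebra_simps)
  qed
  have "z y * (n - z y) * ffact (z y - 1) k
      = (n - real k - 1) * ffact (z y) (k + 1) - ffact (z y) (k + 2)" for y
  proof -
    have "z y * (n - z y) * ffact (z y - 1) k = (n - z y) * ffact (z y) (Suc k)"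
      by (simp add: ffact_Suc_shift)
    also have "\<dots> = (n - real k - 1) * ffact (z y) (Suc k) - ffact (z y) (Suc (Suc k))"
      by (simp add: ffact_Suc[of _ "Suc k"] algebra_simps)
    finally show ?thesis
      by simp
  qed
  then have "(\<Sum>y\<in>C. z y * (n - z y) * ffact (z y - 1) k)
      = (n - real k - 1) * (\<Sum>y\<in>C. ffact (z y) (k + 1)) - (\<Sum>y\<in>C. ffact (z y) (k + 2))"
    by (simp add: sum_subtractf sum_distrib_left)
  also have "\<dots> = (ffact n (k + 1) * (n - real k - 1)) * N * p ^ (k + 1) - ffact n (k + 2) * N * p ^ (k + 2)"
    using k by (simp add: moments)
  also have "\<dots> = n * (n - 1) * N * p * (1 - p) * (ffact (n - 2) k * p ^ k)"
    unfolding n by (simp add: algebra_simps)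
  finally show ?thesis .
qed

text \<open>The weight \<open>z (n - z)\<close> turns the binomial moments on \<open>n\<close> coordinates into those on
  \<open>m = n - 2\<close> coordinates, and the quadratic factor is the monic Krawtchouk polynomial of degree 2
  there: the sum only sees the quadratic coefficient of the cubic after reduction.\<close>

lemma krawtchouk_cubic_sum:
  fixes n N p c :: real and z :: "'a \<Rightarrow> real"
  assumes moments: "\<And>k. k \<le> 7 \<Longrightarrow> (\<Sum>y\<in>C. ffact (z y) k) = ffact n k * N * p ^ k"
  defines "m \<equiv> n - 2"
  shows "(\<Sum>y\<in>C. z y * (n - z y) * (((z y - n / 2) ^ 3 - c * (z y - n / 2))
        * ((z y - 1) * (z y - 2) - 2 * p * (m - 1) * (z y - 1) + m * (m - 1) * p\<^sup>2)))
    = n * (n - 1) * N * p * (1 - p) * (6 * m * (m - 1) * p\<^sup>2 * (1 - p)\<^sup>2 * (1 - 2 * p) * (1 - m / 2))"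
proof -
  \<comment> \<open>With \<open>u = z - 1\<close> the centre \<open>n / 2\<close> becomes
    \<open>m / 2\<close>. The numbers \<open>g\<close>, \<open>e1\<close>, \<open>e0\<close> are the
    coefficients of the cubic in the falling factorial basis, and \<open>c0\<close> to
    \<open>c4\<close> those of its product with the quadratic.\<close>
  define g where "g = 3 - 3 * m / 2"
  define e1 where "e1 = 1 - 3 * m / 2 + 3 * m\<^sup>2 / 4 - c"
  define e0 where "e0 = - (m ^ 3) / 8 + c * m / 2"
  define c0 where "c0 = m * (m - 1) * p\<^sup>2 * e0"
  define c1 where "c1 = - 2 * p * (m - 1) * e1 + m * (m - 1) * p\<^sup>2 * e1 - 2 * p * (m - 1) * e0"
  define c2 where "c2 = 2 * g - 4 * p * (m - 1) * g + m * (m - 1) * p\<^sup>2 * g + 2 * e1 - 2 * p * (m - 1) * e1 + e0"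
  define c3 where "c3 = 6 - 6 * p * (m - 1) + m * (m - 1) * p\<^sup>2 + 4 * g - 2 * p * (m - 1) * g + e1"
  define c4 where "c4 = 6 - 2 * p * (m - 1) + g"
  let ?K = "n * (n - 1) * N * p * (1 - p)"
  have cubic: "(u - m / 2) ^ 3 - c * (u - m / 2) = ffact u 3 + g * ffact u 2 + e1 * ffact u 1 + e0" for u
    unfolding g_def e1_def e0_def
    by (simp add: ffact_numerals power2_eq_square power3_eq_cube field_simps)
  have expand: "(ffact u 3 + g * ffact u 2 + e1 * ffact u 1 + e0) * (u * (u - 1) - 2 * p * (m - 1) * u + m * (m - 1) * p\<^sup>2)
      = ffact u 5 + c4 * ffact u 4 + c3 * ffact u 3 + c2 * ffact u 2 + c1 * ffact u 1 + c0 * ffact u 0" for u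
    unfolding c0_def c1_def c2_def c3_def c4_def
    by (simp add: ffact_numerals power2_eq_square algebra_simps)
  have product: "((z y - n / 2) ^ 3 - c * (z y - n / 2))
        * ((z y - 1) * (z y - 2) - 2 * p * (m - 1) * (z y - 1) + m * (m - 1) * p\<^sup>2)
      = ffact (z y - 1) 5 + c4 * ffact (z y - 1) 4 + c3 * ffact (z y - 1) 3 + c2 * ffact (z y - 1) 2
        + c1 * ffact (z y - 1) 1 + c0 * ffact (z y - 1) 0" for y
  proof -
    have eq: "z y - n / 2 = (z y - 1) - m / 2" "z y - 2 = (z y - 1) - 1"
      unfolding m_def by (simp_all add: field_simps)
    show ?thesis
      unfolding eq cubic expand ..
  qed
  have "(\<Sum>y\<in>C. z y * (n - z y) * (((z y - n / 2) ^ 3 - c * (z y - n / 2))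
        * ((z y - 1) * (z y - 2) - 2 * p * (m - 1) * (z y - 1) + m * (m - 1) * p\<^sup>2)))
    = (\<Sum>y\<in>C. z y * (n - z y) * ffact (z y - 1) 5 + c4 * (z y * (n - z y) * ffact (z y - 1) 4)
        + c3 * (z y * (n - z y) * ffact (z y - 1) 3) + c2 * (z y * (n - z y) * ffact (z y - 1) 2)
        + c1 * (z y * (n - z y) * ffact (z y - 1) 1) + c0 * (z y * (n - z y) * ffact (z y - 1) 0))"
    unfolding product by (simp add: algebra_simps)
  also have "\<dots> = (\<Sum>y\<in>C. z y * (n - z y) * ffact (z y - 1) 5) + c4 * (\<Sum>y\<in>C. z y * (n - z y) * ffact (z y - 1) 4)
        + c3 * (\<Sum>y\<in>C. z y * (n - z y) * ffact (z y - 1) 3) + c2 * (\<Sum>y\<in>C. z y * (n - z y) * ffact (z y - 1) 2)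
        + c1 * (\<Sum>y\<in>C. z y * (n - z y) * ffact (z y - 1) 1) + c0 * (\<Sum>y\<in>C. z y * (n - z y) * ffact (z y - 1) 0)"
    by (simp only: sum.distrib sum_distrib_left)
  also have "\<dots> = ?K * (ffact m 5 * p ^ 5 + c4 * (ffact m 4 * p ^ 4) + c3 * (ffact m 3 * p ^ 3)
      + c2 * (ffact m 2 * p ^ 2) + c1 * (ffact m 1 * p ^ 1) + c0 * (ffact m 0 * p ^ 0))"
    by (simp add: weighted_ffact_sum[OF moments] m_def[symmetric] distrib_left mult.left_commute
        del: ffact_0)
  \<comment> \<open>\<open>e1\<close> and \<open>e0\<close> stay folded: their terms cancel because
    the quadratic is orthogonal to polynomials of degree at most 1. Hence \<open>c\<close> drops
    out.\<close>
  also have "ffact m 5 * p ^ 5 + c4 * (ffact m 4 * p ^ 4) + c3 * (ffact m 3 * p ^ 3)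
      + c2 * (ffact m 2 * p ^ 2) + c1 * (ffact m 1 * p ^ 1) + c0 * (ffact m 0 * p ^ 0)
    = 6 * m * (m - 1) * p\<^sup>2 * (1 - p)\<^sup>2 * (1 - 2 * p) * (1 - m / 2)"
    unfolding c0_def c1_def c2_def c3_def c4_def g_def
    by (simp add: ffact_numerals power2_eq_square field_simps)
  finally show ?thesis .
qed

text \<open>For \<open>p = 1/2\<close> the variable \<open>2 z - n\<close> has the moments of a sum
  of \<open>n\<close> independent signs.\<close>

lemma binary_moments:
  fixes n N :: real and z :: "'a \<Rightarrow> real"
  assumes moments: "\<And>k. k \<le> 6 \<Longrightarrow> (\<Sum>y\<in>C. ffact (z y) k) = ffact n k * N * (1 / 2) ^ k"
  defines "s \<equiv> \<lambda>y. 2 * z y - n"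
  shows "(\<Sum>y\<in>C. s y) = 0" "(\<Sum>y\<in>C. s y ^ 2) = n * N" "(\<Sum>y\<in>C. s y ^ 3) = 0"
    "(\<Sum>y\<in>C. s y ^ 4) = (3 * n\<^sup>2 - 2 * n) * N"
    "(\<Sum>y\<in>C. s y ^ 6) = (15 * n ^ 3 - 30 * n\<^sup>2 + 16 * n) * N"
proof -
  define F where "F = (\<lambda>k. \<Sum>y\<in>C. ffact (z y) k)"
  have F_sum: "(\<Sum>y\<in>C. ffact (z y) k) = F k" for k
    by (simp add: F_def)
  have F: "F k = ffact n k * N * (1 / 2) ^ k" if "k \<le> 6" for k
    using moments[OF that] by (simp add: F_def)
  \<comment> \<open>The bracketed sums turn powers of \<open>z\<close> into falling factorials by
    Stirling numbers of the second kind; the outer coefficients come from the binomial expansion of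
    \<open>2 z - n\<close>.\<close>
  have raw: "s y = 2 * ffact (z y) 1 - n * ffact (z y) 0"
    "s y ^ 2 = 4 * (ffact (z y) 2 + ffact (z y) 1) - 4 * n * ffact (z y) 1 + n\<^sup>2 * ffact (z y) 0"
    "s y ^ 3 = 8 * (ffact (z y) 3 + 3 * ffact (z y) 2 + ffact (z y) 1)
       - 12 * n * (ffact (z y) 2 + ffact (z y) 1) + 6 * n\<^sup>2 * ffact (z y) 1 - n ^ 3 * ffact (z y) 0"
    "s y ^ 4 = 16 * (ffact (z y) 4 + 6 * ffact (z y) 3 + 7 * ffact (z y) 2 + ffact (z y) 1)
       - 32 * n * (ffact (z y) 3 + 3 * ffact (z y) 2 + ffact (z y) 1)
       + 24 * n\<^sup>2 * (ffact (z y) 2 + ffact (z y) 1) - 8 * n ^ 3 * ffact (z y) 1 + n ^ 4 * ffact (z y) 0"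
    "s y ^ 6 = 64 * (ffact (z y) 6 + 15 * ffact (z y) 5 + 65 * ffact (z y) 4 + 90 * ffact (z y) 3 + 31 * ffact (z y) 2 + ffact (z y) 1)
       - 192 * n * (ffact (z y) 5 + 10 * ffact (z y) 4 + 25 * ffact (z y) 3 + 15 * ffact (z y) 2 + ffact (z y) 1)
       + 240 * n\<^sup>2 * (ffact (z y) 4 + 6 * ffact (z y) 3 + 7 * ffact (z y) 2 + ffact (z y) 1)
       - 160 * n ^ 3 * (ffact (z y) 3 + 3 * ffact (z y) 2 + ffact (z y) 1)
       + 60 * n ^ 4 * (ffact (z y) 2 + ffact (z y) 1) - 12 * n ^ 5 * ffact (z y) 1 + n ^ 6 * ffact (z y) 0" for y
    unfolding s_def by (simp_all add: ffact_numerals algebra_simps)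
  note expand = sum.distrib sum_subtractf sum_distrib_left[symmetric] F_sum
  have F': "F 0 = N" "F 1 = n * N / 2" "F 2 = n * (n - 1) * N / 4" "F 3 = n * (n - 1) * (n - 2) * N / 8"
    "F 4 = n * (n - 1) * (n - 2) * (n - 3) * N / 16"
    "F 5 = n * (n - 1) * (n - 2) * (n - 3) * (n - 4) * N / 32"
    "F 6 = n * (n - 1) * (n - 2) * (n - 3) * (n - 4) * (n - 5) * N / 64"
    by (simp_all add: F ffact_numerals)
  show "(\<Sum>y\<in>C. s y) = 0"
    unfolding raw(1) expand F' by simp
  show "(\<Sum>y\<in>C. s y ^ 2) = n * N"
    unfolding raw(2) expand F' by (simp add: power2_eq_square field_simps)
  show "(\<Sum>y\<in>C. s y ^ 3) = 0"
    unfolding raw(3) expand F' by (simp add: power2_eq_square power3_eq_cube field_simps)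
  show "(\<Sum>y\<in>C. s y ^ 4) = (3 * n\<^sup>2 - 2 * n) * N"
    unfolding raw(4) expand F' by (simp add: eval_nat_numeral field_simps)
  show "(\<Sum>y\<in>C. s y ^ 6) = (15 * n ^ 3 - 30 * n\<^sup>2 + 16 * n) * N"
    unfolding raw(5) expand F' by (simp add: eval_nat_numeral field_simps)
qed

section \<open>Admissible parameters\<close>

lemma hamming_dist_pos:
  assumes "x \<in> words n q" "y \<in> words n q" "x \<noteq> y"
  shows "hamming_dist n x y > 0"
proof -
  have "\<exists>i\<in>{1..n}. x i \<noteq> y i"
    using assms unfolding words_def by (metis PiE_ext)
  then show ?thesis
    unfolding hamming_dist_def by (auto simp: card_gt_0_iff)
qed

lemma square_dvd_640:
  fixes y :: int
  assumes "y\<^sup>2 dvd 640" "y > 0"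
  shows "y \<in> {1, 2, 4, 8}"
proof -
  have "y\<^sup>2 \<le> 640"
    using assms by (simp add: zdvd_imp_le)
  then have "y \<le> 25"
    using power_mono[of 26 y 2] by force
  then have "y \<in> {1..25}"
    using assms by simp
  moreover have "{1..25} = {1, 2, 3, 4, 5, 6, 7, 8, 9, 10, 11, 12, 13, 14, 15, 16, 17, 18, 19, 20, 21, 22, 23, 24, 25 :: int}"
    by (simp add: atLeastAtMost_insertL[symmetric] set_eq_iff) presburger
  ultimately show ?thesis
    using assms(1) by auto
qed

lemma design_parameters:
  fixes n q :: nat and C :: "(nat \<Rightarrow> nat) set" and a :: int
  assumes n: "even n" "n \<ge> 8" and q: "q \<ge> 2"
    and C: "hamming_design 7 n q C"
    and a: "a < int n div 2"
    and deg: "int ` degree_set n C = {a, int n div 2, int n - a, int n}"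
  shows "q = 2" and "n = 8 \<and> a = 2 \<or> n = 24 \<and> a = 8 \<and> card C = 4096"
proof -
  have sub: "C \<subseteq> words n q" and ne: "C \<noteq> {}"
    using C unfolding hamming_design_def by blast+
  have fin: "finite C"
    using sub finite_words finite_subset by blast
  obtain x where x: "x \<in> C"
    using ne by blast
  \<comment> \<open>In terms of \<open>s w\<close>, which is \<open>n\<close> minus twice the
    distance from \<open>x\<close>, the degree set becomes the symmetric set
    \<open>y, 0, -y, -n\<close>, and \<open>x\<close> itself has \<open>s x = n\<close>.\<close>
  define y where "y = int n - 2 * a"
  define z where "z = (\<lambda>w. real (agreements n x w))"
  define s where "s = (\<lambda>w. 2 * z w - real n)"
  define N where "N = real (card C)"
  have N: "N > 0"
    using ne fin by (simp add: N_def card_gt_0_iff)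
  have "a \<in> int ` degree_set n C"
    using deg by simp
  then obtain d where d: "a = int d" "d \<in> degree_set n C"
    by blast
  have "d > 0"
    using d(2) sub hamming_dist_pos unfolding degree_set_def by fastforce
  then have a0: "a > 0"
    using d by simp
  have y: "0 < y" "y < int n"
    using a a0 n unfolding y_def by auto
  have sx: "s x = n"
    using agreements_add_hamming_dist[of n x x] unfolding s_def z_def hamming_dist_def by simp
  have s_cases: "s w \<in> {real_of_int y, 0, - real_of_int y, - real n}" if w: "w \<in> C" "w \<noteq> x" for w
  proof -
    have "hamming_dist n x w \<in> degree_set n C"
      using w x unfolding degree_set_def by blast
    then have "int (hamming_dist n x w) \<in> {a, int n div 2, int n - a, int n}"
      using deg by blast
    moreover have "s w = real_of_int (int n - 2 * int (hamming_dist n x w))"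
      using agreements_add_hamming_dist[of n x w] unfolding s_def z_def by linarith
    moreover have "2 * (int n div 2) = int n"
      using n by simp
    ultimately show ?thesis
      unfolding y_def by auto
  qed
  have z_s: "z w = (real n + s w) / 2" for w
    unfolding s_def by simp
  have moments: "(\<Sum>w\<in>C. ffact (z w) k) = ffact n k * N * (1 / real q) ^ k" if "k \<le> 7" for k
    using sum_ffact_agreements[OF C _ x that] n q unfolding z_def N_def by (simp add: power_divide)

  show q2: "q = 2"
  proof -
    define p where "p = 1 / real q"
    define m where "m = real n - 2"
    have zero: "z w * (real n - z w) * (((z w - real n / 2) ^ 3 - (real_of_int y / 2)\<^sup>2 * (z w - real n / 2)) * r) = 0"
      if "w \<in> C" for w r
    proof -
      have "z w * (real n - z w) * (((z w - real n / 2) ^ 3 - (real_of_int y / 2)\<^sup>2 * (z w - real n / 2)) * r)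
          = (real n + s w) * (real n - s w) * s w * (s w - y) * (s w + y) * r / 32"
        unfolding z_s by (simp add: power2_eq_square power3_eq_cube field_simps)
      also have "\<dots> = 0"
        using s_cases[OF that] sx by (cases "w = x") auto
      finally show ?thesis .
    qed
    \<comment> \<open>All factors except \<open>1 - 2 * p\<close> are nonzero, since
      \<open>m \<ge> 6\<close> and \<open>0 < p < 1\<close>.\<close>
    have "n * (real n - 1) * N * p * (1 - p) * (6 * m * (m - 1) * p\<^sup>2 * (1 - p)\<^sup>2 * (1 - 2 * p) * (1 - m / 2)) = 0"
      using krawtchouk_cubic_sum[OF moments, of "(real_of_int y / 2)\<^sup>2"] zero
      unfolding p_def m_def by simp
    moreover have "p > 0" "p < 1" "m \<ge> 6" "real n > 1"
      using q n unfolding p_def m_def by (simp_all add: field_simps)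
    ultimately have "p = 1 / 2"
      using N by auto
    then show ?thesis
      unfolding p_def using q by simp
  qed

  define Y where "Y = real_of_int y"
  define n' where "n' = real n"
  have Y: "0 < Y" "Y < n'"
    using y unfolding Y_def n'_def by linarith+
  have n8: "n' \<ge> 8"
    using n unfolding n'_def by simp
  have mom2: "(\<Sum>w\<in>C. ffact (z w) k) = ffact n' k * N * (1 / 2) ^ k" if "k \<le> 6" for k
    using moments[of k] that q2 unfolding n'_def by simp
  have s': "2 * z w - n' = s w" for w
    unfolding s_def n'_def ..
  have mu: "(\<Sum>w\<in>C. s w) = 0" "(\<Sum>w\<in>C. s w ^ 2) = n' * N" "(\<Sum>w\<in>C. s w ^ 3) = 0"
    "(\<Sum>w\<in>C. s w ^ 4) = (3 * n'\<^sup>2 - 2 * n') * N"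
    "(\<Sum>w\<in>C. s w ^ 6) = (15 * n' ^ 3 - 30 * n'\<^sup>2 + 16 * n') * N"
    using binary_moments[OF mom2] by (simp_all add: s')
  \<comment> \<open>The polynomial vanishing at all values of \<open>s\<close>, times one more
    \<open>s\<close> to make it even: only even moments up to the sixth enter, and they determine
    \<open>Y\<close>.\<close>
  have "(\<Sum>w\<in>C. (n'\<^sup>2 - s w ^ 2) * s w ^ 2 * (s w ^ 2 - Y\<^sup>2)) = 0"
  proof (rule sum.neutral, rule ballI)
    fix w assume "w \<in> C"
    then show "(n'\<^sup>2 - s w ^ 2) * s w ^ 2 * (s w ^ 2 - Y\<^sup>2) = 0"
      using s_cases[of w] sx unfolding Y_def n'_def by (cases "w = x") auto
  qed
  moreover have "(\<Sum>w\<in>C. (n'\<^sup>2 - s w ^ 2) * s w ^ 2 * (s w ^ 2 - Y\<^sup>2))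
      = n'\<^sup>2 * (\<Sum>w\<in>C. s w ^ 4) - (\<Sum>w\<in>C. s w ^ 6) - Y\<^sup>2 * (n'\<^sup>2 * (\<Sum>w\<in>C. s w ^ 2) - (\<Sum>w\<in>C. s w ^ 4))"
    by (simp add: sum_distrib_left sum_subtractf[symmetric] algebra_simps power_add[symmetric])
  ultimately have "n'\<^sup>2 * ((3 * n'\<^sup>2 - 2 * n') * N) - (15 * n' ^ 3 - 30 * n'\<^sup>2 + 16 * n') * N
      - Y\<^sup>2 * (n'\<^sup>2 * (n' * N) - (3 * n'\<^sup>2 - 2 * n') * N) = 0"
    unfolding mu by argo
  then have "N * n' * (n' - 1) * (n' - 2) * ((3 * n' - 8) - Y\<^sup>2) = 0"
    by (simp add: eval_nat_numeral algebra_simps)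
  then have Y2: "Y\<^sup>2 = 3 * n' - 8"
    using N n8 by simp

  \<comment> \<open>This polynomial vanishes at every word but \<open>x\<close>, so its sum gives
    the size of the code.\<close>
  have only_x: "(\<Sum>w\<in>C. s w * (s w ^ 2 - Y\<^sup>2) * (s w + n')) = n' * (n'\<^sup>2 - Y\<^sup>2) * (2 * n')"
  proof -
    have "(\<Sum>w\<in>C. s w * (s w ^ 2 - Y\<^sup>2) * (s w + n')) = (\<Sum>w\<in>{x}. s w * (s w ^ 2 - Y\<^sup>2) * (s w + n'))"
    proof (rule sum.mono_neutral_right)
      show "\<forall>w\<in>C - {x}. s w * (s w ^ 2 - Y\<^sup>2) * (s w + n') = 0"
        using s_cases unfolding Y_def n'_def by fastforce
    qed (use fin x in auto)
    then show ?thesis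
      using sx by (simp add: n'_def)
  qed
  have "(\<Sum>w\<in>C. s w * (s w ^ 2 - Y\<^sup>2) * (s w + n'))
      = (\<Sum>w\<in>C. s w ^ 4) - Y\<^sup>2 * (\<Sum>w\<in>C. s w ^ 2) + n' * (\<Sum>w\<in>C. s w ^ 3) - n' * Y\<^sup>2 * (\<Sum>w\<in>C. s w)"
    by (simp add: sum_distrib_left sum_subtractf[symmetric] sum.distrib[symmetric] algebra_simps eval_nat_numeral)
  then have "(3 * n' - 2 - Y\<^sup>2) * n' * N = 2 * n'\<^sup>2 * (n'\<^sup>2 - Y\<^sup>2)"
    unfolding only_x mu by (simp add: power2_eq_square algebra_simps)
  then have card_C: "6 * n' * N = 2 * n'\<^sup>2 * (n'\<^sup>2 - Y\<^sup>2)"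
    unfolding Y2 by simp

  \<comment> \<open>\<open>A\<close> counts the words at distance \<open>a\<close> from
    \<open>x\<close>. The next polynomial vanishes at all values of \<open>s\<close> except
    \<open>Y\<close>.\<close>
  define A where "A = card {w \<in> C. s w = Y}"
  have only_Y: "(\<Sum>w\<in>C. s w * (n'\<^sup>2 - s w ^ 2) * (s w + Y)) = real A * (2 * Y\<^sup>2 * (n'\<^sup>2 - Y\<^sup>2))"
  proof -
    have "(\<Sum>w\<in>C. s w * (n'\<^sup>2 - s w ^ 2) * (s w + Y)) = (\<Sum>w\<in>{w \<in> C. s w = Y}. s w * (n'\<^sup>2 - s w ^ 2) * (s w + Y))"
    proof (rule sum.mono_neutral_right)
      show "\<forall>w\<in>C - {w \<in> C. s w = Y}. s w * (n'\<^sup>2 - s w ^ 2) * (s w + Y) = 0"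
        using s_cases sx unfolding Y_def n'_def by fastforce
    qed (use fin in auto)
    also have "\<dots> = (\<Sum>w\<in>{w \<in> C. s w = Y}. 2 * Y\<^sup>2 * (n'\<^sup>2 - Y\<^sup>2))"
      by (rule sum.cong) (auto simp: power2_eq_square algebra_simps)
    finally show ?thesis
      by (simp add: A_def)
  qed
  have "(\<Sum>w\<in>C. s w * (n'\<^sup>2 - s w ^ 2) * (s w + Y))
      = n'\<^sup>2 * (\<Sum>w\<in>C. s w ^ 2) - (\<Sum>w\<in>C. s w ^ 4) + Y * n'\<^sup>2 * (\<Sum>w\<in>C. s w) - Y * (\<Sum>w\<in>C. s w ^ 3)"
    by (simp add: sum_distrib_left sum_subtractf[symmetric] sum.distrib[symmetric] algebra_simps eval_nat_numeral)
  then have "real A * (2 * Y\<^sup>2 * (n'\<^sup>2 - Y\<^sup>2)) = N * n' * (n' - 1) * (n' - 2)"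
    unfolding only_Y mu by (simp add: eval_nat_numeral algebra_simps)
  then have "6 * (real A * (2 * Y\<^sup>2 * (n'\<^sup>2 - Y\<^sup>2))) = (6 * n' * N) * (n' - 1) * (n' - 2)"
    by simp
  then have "(6 * real A * Y\<^sup>2 - n'\<^sup>2 * (n' - 1) * (n' - 2)) * (n'\<^sup>2 - Y\<^sup>2) = 0"
    unfolding card_C by (simp add: algebra_simps)
  moreover have "n'\<^sup>2 - Y\<^sup>2 > 0"
    using Y by (simp add: power_strict_mono)
  ultimately have A: "6 * real A * Y\<^sup>2 = n'\<^sup>2 * (n' - 1) * (n' - 2)"
    by simp
  have Y2i: "y\<^sup>2 = 3 * int n - 8"
  proof -
    have "real_of_int (y\<^sup>2) = real_of_int (3 * int n - 8)"
      using Y2 unfolding Y_def n'_def by simp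
    then show ?thesis
      by (simp only: of_int_eq_iff)
  qed
  have Ai: "6 * int A * y\<^sup>2 = (int n)\<^sup>2 * (int n - 1) * (int n - 2)"
  proof -
    have "real_of_int (6 * int A * y\<^sup>2) = real_of_int ((int n)\<^sup>2 * (int n - 1) * (int n - 2))"
      using A unfolding Y_def n'_def by simp
    then show ?thesis
      by (simp only: of_int_eq_iff)
  qed
  \<comment> \<open>Division by \<open>3 n - 8\<close>: the left polynomial takes the value 640 at
    the root \<open>8/3\<close>, and 81 clears the denominators. So \<open>y\<^sup>2\<close> divides
    640.\<close>
  have "81 * ((int n)\<^sup>2 * (int n - 1) * (int n - 2))
      = (3 * int n - 8) * (27 * int n ^ 3 - 9 * int n ^ 2 + 30 * int n + 80) + 640"
    by (simp add: eval_nat_numeral algebra_simps)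
  then have "640 = y\<^sup>2 * (486 * int A - (27 * int n ^ 3 - 9 * int n ^ 2 + 30 * int n + 80))"
    using Ai unfolding Y2i[symmetric] by (simp add: algebra_simps)
  then have "y\<^sup>2 dvd 640"
    by (rule dvdI)
  then have "y \<in> {1, 2, 4, 8}"
    using square_dvd_640 y by blast
  then have "y = 4 \<and> n = 8 \<or> y = 8 \<and> n = 24"
    using Y2i n by auto
  moreover have "card C = 4096" if "y = 8" "n = 24"
    using card_C that unfolding Y_def n'_def N_def by simp
  ultimately show "n = 8 \<and> a = 2 \<or> n = 24 \<and> a = 8 \<and> card C = 4096"
    unfolding y_def by auto
qed

section \<open>Recognising binary codes\<close>

text \<open>Over two symbols a word is determined by where it differs from \<open>x\<close>, so
  translating by \<open>x\<close> is injective and inclusion in \<open>B\<close> becomes equality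
  once \<open>B\<close> is no larger than \<open>C\<close>. The symbol permutation at
  \<open>i\<close> moves the symbol of \<open>x\<close> to 1, which encodes the bit 0.\<close>

lemma binary_code_isomorphicI:
  assumes C: "C \<subseteq> words n 2" and x: "x \<in> C" and \<pi>: "\<pi> permutes {1..n}"
    and B: "\<And>c. c \<in> C \<Longrightarrow> (\<lambda>i\<in>{1..n}. if c (\<pi> i) = x (\<pi> i) then 0 else 1) \<in> B"
    and card: "finite B" "card B \<le> card C"
  shows "code_isomorphic n 2 C (of_binary n B)"
proof -
  define \<beta> where "\<beta> = (\<lambda>c. \<lambda>i\<in>{1..n}. if c (\<pi> i) = x (\<pi> i) then 0 else (1 :: bit))"
  define \<sigma> where "\<sigma> = (\<lambda>i. transpose (1 :: nat) (x (\<pi> i)))"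
  have symbol: "c (\<pi> i) \<in> {1, 2}" if "c \<in> C" "i \<in> {1..n}" for c i
  proof -
    have "c \<in> words n 2" "\<pi> i \<in> {1..n}"
      using that C permutes_in_image[OF \<pi>, of i] by auto
    then show ?thesis
      unfolding words_def by (fastforce simp: PiE_def Pi_def)
  qed
  have inj: "inj_on \<beta> C"
  proof (rule inj_onI)
    fix c d assume cd: "c \<in> C" "d \<in> C" "\<beta> c = \<beta> d"
    have "c i = d i" if i: "i \<in> {1..n}" for i
    proof -
      obtain j where j: "j \<in> {1..n}" "i = \<pi> j"
        using permutes_image[OF \<pi>] i by blast
      have "(c (\<pi> j) = x (\<pi> j)) = (d (\<pi> j) = x (\<pi> j))"
        using fun_cong[OF cd(3), of j] j unfolding \<beta>_def by (auto split: if_splits)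
      then show ?thesis
        using symbol[OF cd(1) j(1)] symbol[OF cd(2) j(1)] symbol[OF x j(1)] j by auto
    qed
    then show "c = d"
      using PiE_ext[of c "{1..n}" "\<lambda>_. {1..2}" d] cd(1,2) C unfolding words_def by blast
  qed
  have "\<beta> ` C = B"
  proof (rule card_seteq)
    show "\<beta> ` C \<subseteq> B"
      using B unfolding \<beta>_def by blast
  qed (use card card_image[OF inj] in auto)
  then have "of_binary n B = (\<lambda>c. \<lambda>i\<in>{1..n}. if \<beta> c i = 0 then 1 else 2) ` C"
    unfolding of_binary_def by auto
  also have "\<dots> = (\<lambda>c. \<lambda>i\<in>{1..n}. \<sigma> i (c (\<pi> i))) ` C"
  proof (rule image_cong)
    fix c assume c: "c \<in> C"
    have "(if \<beta> c i = 0 then 1 else 2) = \<sigma> i (c (\<pi> i))" if i: "i \<in> {1..n}" for i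
      using symbol[OF c i] symbol[OF x i] i unfolding \<beta>_def \<sigma>_def
      by (auto simp: transpose_def)
    then show "(\<lambda>i\<in>{1..n}. if \<beta> c i = 0 then 1 else 2) = (\<lambda>i\<in>{1..n}. \<sigma> i (c (\<pi> i)))"
      by (auto simp: restrict_def)
  qed simp
  finally have "of_binary n B = (\<lambda>c. \<lambda>i\<in>{1..n}. \<sigma> i (c (\<pi> i))) ` C" .
  moreover have "\<sigma> i permutes {1..2}" if "i \<in> {1..n}" for i
    unfolding \<sigma>_def using symbol[OF x that] by (intro permutes_swap_id) auto
  ultimately show ?thesis
    unfolding code_isomorphic_def using \<pi> by blast
qed

lemma UNIV_bit: "(UNIV :: bit set) = {0, 1}"
  using bit_not_zero_iff by blast

lemma card_UNIV_bit: "card (UNIV :: bit set) = 2"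
  unfolding UNIV_bit by simp

lemma finite_binary_vectors: "finite (binary_vectors n)"
  unfolding binary_vectors_def by (intro finite_PiE) (auto simp: UNIV_bit)

lemma design_card_ge:
  assumes C: "hamming_design t n q C" and t: "t \<le> n"
  shows "q ^ t \<le> card C"
proof -
  obtain x where x: "x \<in> C"
    using C unfolding hamming_design_def by blast
  have fin: "finite C"
    using C finite_words finite_subset unfolding hamming_design_def by blast
  have "card {y \<in> C. \<forall>i\<in>{1..t}. y i = x i} * q ^ t = card C"
    using agreement_count[OF C t x, of "{1..t}"] t by simp
  moreover have "card {y \<in> C. \<forall>i\<in>{1..t}. y i = x i} > 0"
    using x fin by (auto simp: card_gt_0_iff)
  ultimately show ?thesis
    using mult_le_mono1[of 1 "card {y \<in> C. \<forall>i\<in>{1..t}. y i = x i}" "q ^ t"] by simp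
qed

section \<open>The even-weight code\<close>

lemma card_even_weight_le:
  assumes "n > 0"
  shows "card {v \<in> binary_vectors n. even (card {i \<in> {1..n}. v i = 1})} \<le> 2 ^ (n - 1)"
proof -
  let ?E = "{v \<in> binary_vectors n. even (card {i \<in> {1..n}. v i = 1})}"
  have "inj_on (\<lambda>v. restrict v {2..n}) ?E"
  proof (rule inj_onI)
    fix v w assume v: "v \<in> ?E" and w: "w \<in> ?E" and eq: "restrict v {2..n} = restrict w {2..n}"
    have tail: "v i = w i" if "i \<in> {2..n}" for i
      using fun_cong[OF eq, of i] that by simp
    have split: "card {i \<in> {1..n}. u i = 1} = of_bool (u 1 = 1) + card {i \<in> {2..n}. u i = 1}" for u :: "nat \<Rightarrow> bit"
    proof -
      have "{1..n} = insert 1 {2..n}"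
        using assms by auto
      moreover have "{i \<in> insert 1 {2..n}. u i = 1} = (if u 1 = 1 then insert 1 {i \<in> {2..n}. u i = 1} else {i \<in> {2..n}. u i = 1})"
        by auto
      ultimately show ?thesis
        by simp
    qed
    have "{i \<in> {2..n}. v i = 1} = {i \<in> {2..n}. w i = 1}"
      using tail by auto
    then have "(v 1 = 1) = (w 1 = 1)"
      using v w split[of v] split[of w] by (cases "v 1 = 1"; cases "w 1 = 1") simp_all
    then have "v 1 = w 1"
      by (cases "v 1"; cases "w 1") auto
    have "v i = w i" if "i \<in> {1..n}" for i
      using tail[of i] \<open>v 1 = w 1\<close> that by (cases "i = 1") auto
    then show "v = w"
      using PiE_ext[of v "{1..n}" "\<lambda>_. UNIV" w] v w unfolding binary_vectors_def by blast
  qed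
  moreover have "(\<lambda>v. restrict v {2..n}) ` ?E \<subseteq> {2..n} \<rightarrow>\<^sub>E UNIV"
    by auto
  ultimately have "card ?E \<le> card ({2..n} \<rightarrow>\<^sub>E (UNIV :: bit set))"
    by (intro card_inj_on_le) (auto intro!: finite_PiE simp: UNIV_bit)
  also have "\<dots> = 2 ^ (n - 1)"
    by (simp add: card_PiE card_UNIV_bit)
  finally show ?thesis .
qed

text \<open>Strength \<open>n - 1\<close> forces at least \<open>2 ^ (n - 1)\<close> words, and
  translating by a codeword puts them all among the even-weight vectors, of which there are no
  more.\<close>

lemma even_distances_isomorphic:
  assumes C: "hamming_design (n - 1) n 2 C" and n: "n > 0"
    and even: "\<And>x y. x \<in> C \<Longrightarrow> y \<in> C \<Longrightarrow> even (hamming_dist n x y)"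
  shows "code_isomorphic n 2 C (of_binary n (binary_dual n (binary_repetition n)))"
proof -
  obtain x where x: "x \<in> C"
    using C unfolding hamming_design_def by blast
  let ?E = "binary_dual n (binary_repetition n)"
  show ?thesis
  proof (rule binary_code_isomorphicI[where \<pi> = id])
    show "C \<subseteq> words n 2"
      using C unfolding hamming_design_def by blast
    show "finite ?E"
      unfolding binary_dual_def using finite_binary_vectors by simp
    show "card ?E \<le> card C"
      using card_even_weight_le[OF n] design_card_ge[OF C]
      unfolding binary_dual_repetition_eq_even_weight by simp
    fix c assume c: "c \<in> C"
    have "{i \<in> {1..n}. (\<lambda>i\<in>{1..n}. if c (id i) = x (id i) then 0 else 1 :: bit) i = 1} = {i \<in> {1..n}. x i \<noteq> c i}"
      by auto
    then show "(\<lambda>i\<in>{1..n}. if c (id i) = x (id i) then 0 else 1) \<in> ?E"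
      using even[OF x c] unfolding binary_dual_repetition_eq_even_weight hamming_dist_def binary_vectors_def
      by simp
  qed (use x in \<open>auto simp: permutes_id\<close>)
qed

section \<open>Uniqueness of the biplane on 11 points\<close>

lemma card_Int_insert3:
  assumes "distinct [a, b, c]"
  shows "card (S \<inter> {a, b, c}) = of_bool (a \<in> S) + of_bool (b \<in> S) + of_bool (c \<in> S)"
  using assms by (auto simp: Int_insert_right)

text \<open>\<open>S\<close> plays the triple of a pair \<open>{q, p3}\<close> against the triples
  of \<open>{p1, p2}\<close>, \<open>{p3, p4}\<close>, \<open>{p3, p5}\<close> and
  \<open>{p4, p5}\<close>: disjoint pairs have triples meeting in two points, pairs sharing a point
  have triples meeting in one.\<close>

lemma triple_cases:
  assumes d: "distinct [a, b, c, x, y, z]" and S: "S \<subseteq> {a, b, c, x, y, z}" "card S = 3"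
    and int: "card (S \<inter> {a, b, c}) = 1" "card (S \<inter> {a, b, z}) = 1" "card (S \<inter> {a, c, y}) = 1"
      "card (S \<inter> {b, c, x}) = 2"
  shows "S = {b, x, y} \<or> S = {c, x, z}"
proof -
  have "S = (S \<inter> {a, b, c}) \<union> (S \<inter> {x, y, z})"
    using S by auto
  then have "card S = card (S \<inter> {a, b, c}) + card (S \<inter> {x, y, z})"
    using d card_Un_disjoint[of "S \<inter> {a, b, c}" "S \<inter> {x, y, z}"] by auto
  then have int': "card (S \<inter> {x, y, z}) = 2"
    using S int by simp
  have dd: "distinct [a, b, c]" "distinct [a, b, z]" "distinct [a, c, y]" "distinct [b, c, x]" "distinct [x, y, z]"
    using d by auto
  note * = int[unfolded card_Int_insert3[OF dd(1)] card_Int_insert3[OF dd(2)] card_Int_insert3[OF dd(3)]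
      card_Int_insert3[OF dd(4)]] int'[unfolded card_Int_insert3[OF dd(5)]]
  have "(a \<notin> S \<and> b \<in> S \<and> c \<notin> S \<and> x \<in> S \<and> y \<in> S \<and> z \<notin> S)
      \<or> (a \<notin> S \<and> b \<notin> S \<and> c \<in> S \<and> x \<in> S \<and> y \<notin> S \<and> z \<in> S)"
    using * by (cases "a \<in> S"; cases "b \<in> S"; cases "c \<in> S"; cases "x \<in> S"; cases "y \<in> S"; cases "z \<in> S"; simp)
  then show ?thesis
  proof (elim disjE conjE)
    assume "a \<notin> S" "b \<in> S" "c \<notin> S" "x \<in> S" "y \<in> S" "z \<notin> S"
    then have "S = {b, x, y}"
      using S(1) by blast
    then show ?thesis ..
  next
    assume "a \<notin> S" "b \<notin> S" "c \<in> S" "x \<in> S" "y \<notin> S" "z \<in> S"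
    then have "S = {c, x, z}"
      using S(1) by blast
    then show ?thesis ..
  qed
qed

lemma triple_meet_in_pair:
  assumes "card S = 3" "card T = 3" "card (S \<inter> T) = 2"
  obtains s t where "S - T = {s}" "T - S = {t}"
proof -
  have "finite S" "finite T"
    using assms by (auto intro: card_ge_0_finite)
  then have "card (S - T) = 1" "card (T - S) = 1"
    using assms by (simp_all add: card_Diff_subset_Int Int_commute)
  then show ?thesis
    using that by (auto simp: card_1_singleton_iff)
qed

text \<open>Each \<open>T\<close> trades one point of \<open>S\<close> for a new one. Two of them
  cannot drop the same point, nor gain the same point, since either way they would meet in two
  points.\<close>

lemma three_triples_on_triple:
  assumes S: "card S = 3" and T: "card T1 = 3" "card T2 = 3" "card T3 = 3"
    and ST: "card (S \<inter> T1) = 2" "card (S \<inter> T2) = 2" "card (S \<inter> T3) = 2"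
    and TT: "card (T1 \<inter> T2) = 1" "card (T1 \<inter> T3) = 1" "card (T2 \<inter> T3) = 1"
  obtains a b c x y z where "distinct [a, b, c, x, y, z]" "S = {a, b, c}"
    "T1 = {a, b, z}" "T2 = {a, c, y}" "T3 = {b, c, x}"
proof -
  obtain c z where 1: "S - T1 = {c}" "T1 - S = {z}"
    using triple_meet_in_pair[OF S T(1) ST(1)] .
  obtain b y where 2: "S - T2 = {b}" "T2 - S = {y}"
    using triple_meet_in_pair[OF S T(2) ST(2)] .
  obtain a x where 3: "S - T3 = {a}" "T3 - S = {x}"
    using triple_meet_in_pair[OF S T(3) ST(3)] .
  have fin: "finite S" "finite T1" "finite T2" "finite T3"
    using S T by (auto intro: card_ge_0_finite)
  have pair: "u \<noteq> v \<and> s \<noteq> t"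
    if A: "finite A" "card (S \<inter> A) = 2" and AB: "card (A \<inter> B) = 1"
      and u: "S - A = {u}" "A - S = {s}" and v: "S - B = {v}" "B - S = {t}" for A B u v s t
  proof
    show "u \<noteq> v"
    proof
      assume "u = v"
      then have "S \<inter> A \<subseteq> A \<inter> B"
        using u v by blast
      then have "card (S \<inter> A) \<le> card (A \<inter> B)"
        using A by (intro card_mono) auto
      then show False
        using A AB by simp
    qed
    have "card (S \<inter> A - {v}) \<ge> 1"
      using A fin by (simp add: card_Diff_singleton_if)
    then obtain w where w: "w \<in> S \<inter> A - {v}"
      by (metis card.empty ex_in_conv not_one_le_zero)
    show "s \<noteq> t"
    proof
      assume "s = t"
      then have "{w, s} \<subseteq> A \<inter> B" "w \<noteq> s"
        using w u v by blast+
      then have "card {w, s} \<le> card (A \<inter> B)"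
        using A by (intro card_mono) auto
      then show False
        using AB \<open>w \<noteq> s\<close> by simp
    qed
  qed
  have ne: "c \<noteq> b" "z \<noteq> y" "c \<noteq> a" "z \<noteq> x" "b \<noteq> a" "y \<noteq> x"
    using pair[OF fin(2) ST(1) TT(1) 1 2] pair[OF fin(2) ST(1) TT(2) 1 3] pair[OF fin(3) ST(2) TT(3) 2 3] by auto
  have "{a, b, c} \<subseteq> S"
    using 1 2 3 by blast
  then have Seq: "{a, b, c} = S"
    using fin S ne by (intro card_seteq) auto
  have mem: "x \<notin> S" "y \<notin> S" "z \<notin> S"
    using 1(2) 2(2) 3(2) by (metis DiffD2 insertI1)+
  have T_eq: "B = S - {v} \<union> {t}" if "S - B = {v}" "B - S = {t}" for B v t
    using that by blast
  show ?thesis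
  proof (rule that)
    show "distinct [a, b, c, x, y, z]"
      using ne mem unfolding Seq[symmetric] by auto
    show "S = {a, b, c}"
      using Seq ..
    show "T1 = {a, b, z}" "T2 = {a, c, y}" "T3 = {b, c, x}"
      using ne by (simp_all add: T_eq[OF 1] T_eq[OF 2] T_eq[OF 3] Seq[symmetric] insert_Diff_if insert_commute)
  qed
qed

text \<open>The residual of a biplane on 11 points at a block: \<open>T e\<close> is the rest of the block that meets the
  given block in the pair \<open>e\<close>. The only choice in the labelling is the order of \<open>p1\<close> and \<open>p2\<close>.\<close>

lemma triple_system_unique:
  assumes d: "distinct [p1, p2, p3, p4, p5]" and X: "card X = 6"
    and sub: "\<And>e. e \<subseteq> {p1, p2, p3, p4, p5} \<Longrightarrow> card e = 2 \<Longrightarrow> T e \<subseteq> X \<and> card (T e) = 3"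
    and int: "\<And>e f. e \<subseteq> {p1, p2, p3, p4, p5} \<Longrightarrow> card e = 2 \<Longrightarrow> f \<subseteq> {p1, p2, p3, p4, p5} \<Longrightarrow> card f = 2
      \<Longrightarrow> e \<noteq> f \<Longrightarrow> card (T e \<inter> T f) + card (e \<inter> f) = 2"
  obtains q1 q2 a b c x y z where
    "{q1, q2} = {p1, p2}" "distinct [a, b, c, x, y, z]" "X = {a, b, c, x, y, z}"
    "T {q1, q2} = {a, b, c}" "T {p3, p4} = {a, b, z}" "T {p3, p5} = {a, c, y}" "T {p4, p5} = {b, c, x}"
    "T {q1, p3} = {b, x, y}" "T {q2, p3} = {c, x, z}" "T {q1, p4} = {c, y, z}" "T {q2, p4} = {a, x, y}"
    "T {q1, p5} = {a, x, z}" "T {q2, p5} = {b, y, z}"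
proof -
  let ?Q = "{p1, p2, p3, p4, p5}"
  have finX: "finite X"
    using X by (auto intro: card_ge_0_finite)
  have edge: "T {p, q} \<subseteq> X" "card (T {p, q}) = 3" if "p \<in> ?Q" "q \<in> ?Q" "p \<noteq> q" for p q
    using sub[of "{p, q}"] that by auto
  have meet: "card (T {p, q} \<inter> T {p, r}) = 1" if "distinct [p, q, r]" "{p, q, r} \<subseteq> ?Q" for p q r
    using int[of "{p, q}" "{p, r}"] that by (auto simp: doubleton_eq_iff)
  have apart: "card (T {p, q} \<inter> T {r, s}) = 2" if "distinct [p, q, r, s]" "{p, q, r, s} \<subseteq> ?Q" for p q r s
    using int[of "{p, q}" "{r, s}"] that by (auto simp: doubleton_eq_iff)
  have ne: "p1 \<noteq> p2" "p1 \<noteq> p3" "p1 \<noteq> p4" "p1 \<noteq> p5" "p2 \<noteq> p3" "p2 \<noteq> p4" "p2 \<noteq> p5"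
    "p3 \<noteq> p4" "p3 \<noteq> p5" "p4 \<noteq> p5"
    using d by auto
  have triples: "card (T {p1, p2}) = 3" "card (T {p3, p4}) = 3" "card (T {p3, p5}) = 3" "card (T {p4, p5}) = 3"
    by (simp_all add: edge ne)
  have pairs: "card (T {p1, p2} \<inter> T {p3, p4}) = 2" "card (T {p1, p2} \<inter> T {p3, p5}) = 2" "card (T {p1, p2} \<inter> T {p4, p5}) = 2"
    by (simp_all add: apart ne)
  have points: "card (T {p3, p4} \<inter> T {p3, p5}) = 1" "card (T {p3, p4} \<inter> T {p4, p5}) = 1" "card (T {p3, p5} \<inter> T {p4, p5}) = 1"
    using meet[of p3 p4 p5] meet[of p4 p3 p5] meet[of p5 p3 p4] ne by (simp_all add: insert_commute)
  obtain a b c x y z where T: "distinct [a, b, c, x, y, z]" "T {p1, p2} = {a, b, c}"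
    "T {p3, p4} = {a, b, z}" "T {p3, p5} = {a, c, y}" "T {p4, p5} = {b, c, x}"
    using three_triples_on_triple[OF triples pairs points] .
  have Xeq: "{a, b, c, x, y, z} = X"
  proof (rule card_seteq[OF finX])
    show "{a, b, c, x, y, z} \<subseteq> X"
      using edge(1)[of p1 p2] edge(1)[of p3 p4] edge(1)[of p3 p5] edge(1)[of p4 p5] d unfolding T by auto
  qed (use T(1) X in auto)
  have at3: "T {q, p3} = {b, x, y} \<or> T {q, p3} = {c, x, z}"
    and at4: "T {q, p4} = {a, x, y} \<or> T {q, p4} = {c, y, z}"
    and at5: "T {q, p5} = {a, x, z} \<or> T {q, p5} = {b, y, z}"
    if q: "{q, r} = {p1, p2}" for q r
  proof -
    have dq: "distinct [q, r, p3, p4, p5]" and Q: "{q, r} \<union> {p3, p4, p5} = ?Q"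
      using q d by (auto simp: doubleton_eq_iff)
    have Tqr: "T {q, r} = {a, b, c}"
      using T q by simp
    have s: "{q, p3} = {p3, q}" "{q, p4} = {p4, q}" "{q, p5} = {p5, q}"
      "{p3, p4} = {p4, p3}" "{p3, p5} = {p5, p3}" "{p4, p5} = {p5, p4}"
      by auto
    have m: "card (T {q, u} \<inter> {a, b, c}) = 1" if "u \<in> {p3, p4, p5}" for u
      using meet[of q u r] dq Q that unfolding Tqr by auto
    have ne: "q \<noteq> p3" "q \<noteq> p4" "q \<noteq> p5" "p3 \<noteq> p4" "p3 \<noteq> p5" "p4 \<noteq> p5" "q \<in> ?Q"
      using dq q by auto
    have X3: "T {q, u} \<subseteq> {a, b, c, x, y, z}" "card (T {q, u}) = 3" if "u \<in> {p3, p4, p5}" for u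
      using edge[of q u] that ne unfolding Xeq by auto
    have m3: "card (T {q, p3} \<inter> {a, b, z}) = 1" "card (T {q, p3} \<inter> {a, c, y}) = 1" "card (T {q, p3} \<inter> {b, c, x}) = 2"
      using meet[of p3 q p4] meet[of p3 q p5] apart[of q p3 p4 p5] ne unfolding T s(1) by simp_all
    show "T {q, p3} = {b, x, y} \<or> T {q, p3} = {c, x, z}"
      by (rule triple_cases[OF T(1) X3 m m3]) simp_all
    \<comment> \<open>The other two cases follow from the first by symmetry: swapping
      \<open>p3\<close> and \<open>p4\<close> swaps \<open>a\<close> with \<open>b\<close> and
      \<open>x\<close> with \<open>y\<close>; the cycle \<open>p3\<close> to \<open>p5\<close> to
      \<open>p4\<close> to \<open>p3\<close> carries \<open>a, b, c\<close> to
      \<open>c, a, b\<close> and \<open>x, y, z\<close> to \<open>z, x, y\<close>.\<close>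
    have perm: "distinct [b, a, c, y, x, z]" "distinct [c, a, b, z, x, y]"
      using T(1) by auto
    have m4: "card (T {q, p4} \<inter> {b, a, z}) = 1" "card (T {q, p4} \<inter> {b, c, x}) = 1" "card (T {q, p4} \<inter> {a, c, y}) = 2"
      using meet[of p4 q p3] meet[of p4 q p5] apart[of q p4 p3 p5] ne unfolding T s(2) s(4)[symmetric]
      by (simp_all add: insert_commute)
    show "T {q, p4} = {a, x, y} \<or> T {q, p4} = {c, y, z}"
      using triple_cases[of b a c y x z "T {q, p4}"] m4 m[of p4] X3[of p4] perm
      by (simp add: insert_commute)
    have m5: "card (T {q, p5} \<inter> {c, a, y}) = 1" "card (T {q, p5} \<inter> {c, b, x}) = 1" "card (T {q, p5} \<inter> {a, b, z}) = 2"
      using meet[of p5 q p3] meet[of p5 q p4] apart[of q p5 p3 p4] ne unfolding T s(3) s(5,6)[symmetric]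
      by (simp_all add: insert_commute)
    show "T {q, p5} = {a, x, z} \<or> T {q, p5} = {b, y, z}"
      using triple_cases[of c a b z x y "T {q, p5}"] m5 m[of p5] X3[of p5] perm
      by (simp add: insert_commute)
  qed
  have two: "card ({b, x, y} \<inter> {a, x, y}) = 2" "card ({b, x, y} \<inter> {b, y, z}) = 2" "card ({b, x, y} \<inter> {b, x, y}) = 3"
    "card ({c, y, z} \<inter> {c, y, z}) = 3" "card ({a, x, z} \<inter> {a, x, z}) = 3" "card ({c, x, z} \<inter> {c, x, z}) = 3"
    using T(1) by (auto simp: Int_insert_left)
  note labelling = that
  \<comment> \<open>One of the two choices at \<open>p3\<close> decides all others, because triples
    of pairs sharing a point meet in exactly one point. The opposite choice becomes this one after
    swapping \<open>p1\<close> and \<open>p2\<close>.\<close>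
  have finish: thesis if q: "{q1, q2} = {p1, p2}" and T13: "T {q1, p3} = {b, x, y}" for q1 q2
  proof (rule labelling[of q1 q2 a b c x y z])
    have dq: "distinct [q1, q2, p3, p4, p5]" and Q: "{q1, q2} \<union> {p3, p4, p5} = ?Q"
      using q d by (auto simp: doubleton_eq_iff)
    have q': "{q2, q1} = {p1, p2}"
      using q by auto
    have same: "card (T {q1, u} \<inter> T {q2, u}) = 1" if "u \<in> {p3, p4, p5}" for u
      using meet[of u q1 q2] dq Q that by (auto simp: insert_commute)
    have star: "card (T {q1, p3} \<inter> T {q1, u}) = 1" if "u \<in> {p4, p5}" for u
      using meet[of q1 p3 u] dq Q that by auto
    show T14: "T {q1, p4} = {c, y, z}"
      by (rule disjE[OF at4[OF q]]) (use star[of p4, unfolded T13] two in simp_all)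
    show T15: "T {q1, p5} = {a, x, z}"
      by (rule disjE[OF at5[OF q]]) (use star[of p5, unfolded T13] two in simp_all)
    show "T {q2, p3} = {c, x, z}"
      by (rule disjE[OF at3[OF q']]) (use same[of p3, unfolded T13] two in simp_all)
    show "T {q2, p4} = {a, x, y}"
      by (rule disjE[OF at4[OF q']]) (use same[of p4, unfolded T14] two in simp_all)
    show "T {q2, p5} = {b, y, z}"
      by (rule disjE[OF at5[OF q']]) (use same[of p5, unfolded T15] two in simp_all)
  qed (use q T T13 Xeq in auto)
  show thesis
  proof (cases "T {p1, p3} = {b, x, y}")
    case True
    then show ?thesis
      using finish[of p1 p2] by blast
  next
    case False
    then have T13: "T {p1, p3} = {c, x, z}"
      using at3[of p1 p2] by blast
    have same: "card (T {p1, p3} \<inter> T {p2, p3}) = 1"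
      using meet[of p3 p1 p2] d by (auto simp: insert_commute)
    have "T {p2, p3} = {b, x, y}"
      by (rule disjE[OF at3[of p2 p1]]) (use same[unfolded T13] two in auto)
    then show ?thesis
      using finish[of p2 p1] by blast
  qed
qed

text \<open>The first block is \<open>{0,\<dots>,4}\<close>; every other block meets it in a pair, and the order is that in
  which \<open>triple_system_unique\<close> lists the pairs.\<close>

definition biplane_blocks :: "nat list list"
  where "biplane_blocks = [[0, 1, 2, 3, 4], [0, 1, 5, 6, 7], [2, 3, 5, 6, 10], [2, 4, 5, 7, 9], [3, 4, 6, 7, 8],
    [0, 2, 6, 8, 9], [1, 2, 7, 8, 10], [0, 3, 7, 9, 10], [1, 3, 5, 8, 9], [0, 4, 5, 8, 10], [1, 4, 6, 9, 10]]"

lemma card_5_obtain: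
  assumes "card A = 5"
  obtains p1 p2 p3 p4 p5 where "A = {p1, p2, p3, p4, p5}" "distinct [p1, p2, p3, p4, p5]"
proof -
  have "finite A"
    using assms by (auto intro: card_ge_0_finite)
  then obtain ps where ps: "set ps = A" "distinct ps"
    using finite_distinct_list by blast
  then have "length ps = 5"
    using assms distinct_card by fastforce
  then obtain p1 p2 p3 p4 p5 where "ps = [p1, p2, p3, p4, p5]"
    by (auto simp: length_Suc_conv numeral_eq_Suc)
  then show ?thesis
    using that ps by auto
qed

lemma biplane_unique:
  assumes I: "card I = 11" and P: "card P = 11"
    and B: "\<And>i. i \<in> I \<Longrightarrow> B i \<subseteq> P" "\<And>i. i \<in> I \<Longrightarrow> card (B i) = 5"
    and BB: "\<And>i j. i \<in> I \<Longrightarrow> j \<in> I \<Longrightarrow> i \<noteq> j \<Longrightarrow> card (B i \<inter> B j) = 2"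
  obtains ls ps where "distinct ls" "set ls = I" "distinct ps" "set ps = P"
    "map B ls = map (\<lambda>b. set (map ((!) ps) b)) biplane_blocks"
proof -
  have fin: "finite I" "finite P"
    using I P by (auto intro: card_ge_0_finite)
  have finB: "finite (B i)" if "i \<in> I" for i
    using B(1)[OF that] fin finite_subset by blast
  obtain i0 where i0: "i0 \<in> I"
    using I by (metis card.empty ex_in_conv zero_neq_numeral)
  obtain p1 p2 p3 p4 p5 where B0: "B i0 = {p1, p2, p3, p4, p5}" and d: "distinct [p1, p2, p3, p4, p5]"
    using card_5_obtain[OF B(2)[OF i0]] .
  define X where "X = P - B i0"
  define E where "E = (\<lambda>i. B i \<inter> B i0)"
  define R where "R = (\<lambda>i. B i - B i0)"
  have X: "card X = 6"
    unfolding X_def using B[OF i0] P fin finB[OF i0] by (simp add: card_Diff_subset)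
  have finX: "finite X"
    unfolding X_def using fin by simp
  have E: "card (E i) = 2" "E i \<subseteq> B i0" if "i \<in> I - {i0}" for i
    using BB[of i i0] that i0 unfolding E_def by auto
  have R: "card (R i) = 3" "R i \<subseteq> X" if "i \<in> I - {i0}" for i
    using that B(1)[of i] B(2)[of i] E(1)[OF that] finB[of i] unfolding R_def X_def E_def
    by (auto simp: card_Diff_subset_Int)
  have ER: "card (R i \<inter> R j) + card (E i \<inter> E j) = 2" if "i \<in> I" "j \<in> I" "i \<noteq> j" for i j
  proof -
    have "B i \<inter> B j = (R i \<inter> R j) \<union> (E i \<inter> E j)"
      unfolding R_def E_def by blast
    moreover have "card ((R i \<inter> R j) \<union> (E i \<inter> E j)) = card (R i \<inter> R j) + card (E i \<inter> E j)"
      by (rule card_Un_disjoint) (use finB that in \<open>auto simp: R_def E_def\<close>)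
    ultimately show ?thesis
      using BB[OF that] by simp
  qed
  \<comment> \<open>Two blocks with the same trace on \<open>B i0\<close> would have disjoint rests,
    splitting the six points of \<open>X\<close> into triples. A third block would meet both triples
    equally often, yet its rest has three points.\<close>
  have inj: "inj_on E (I - {i0})"
  proof (rule inj_onI, rule ccontr)
    fix i j assume i: "i \<in> I - {i0}" and j: "j \<in> I - {i0}" and eq: "E i = E j" and ne: "i \<noteq> j"
    have disj: "R i \<inter> R j = {}"
      using ER[of i j] i j ne E(1)[OF i] eq finB[of i] by (simp add: R_def)
    have "R i \<union> R j = X"
    proof (rule card_seteq[OF finX])
      show "R i \<union> R j \<subseteq> X"
        using R i j by blast
      have "card (R i \<union> R j) = 6"
        using card_Un_disjoint[OF _ _ disj] R(1)[OF i] R(1)[OF j] finB i j by (simp add: R_def)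
      then show "card X \<le> card (R i \<union> R j)"
        using X by simp
    qed
    have "card (I - {i0, i, j}) > 0"
      using I fin i0 i j ne by (subst card_Diff_subset) auto
    then obtain k where k: "k \<in> I - {i0, i, j}"
      by (metis card.empty ex_in_conv less_numeral_extra(3))
    have "R k = (R k \<inter> R i) \<union> (R k \<inter> R j)"
      using R(2)[of k] k \<open>R i \<union> R j = X\<close> by auto
    moreover have "card ((R k \<inter> R i) \<union> (R k \<inter> R j)) = card (R k \<inter> R i) + card (R k \<inter> R j)"
      by (rule card_Un_disjoint) (use disj finB[of k] k in \<open>auto simp: R_def\<close>)
    ultimately have "card (R k \<inter> R i) + card (R k \<inter> R j) = 3"
      using R(1)[of k] k by auto
    moreover have "card (R k \<inter> R i) + card (E k \<inter> E i) = 2" "card (R k \<inter> R j) + card (E k \<inter> E i) = 2"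
      using ER[of k i] ER[of k j] i j k eq by auto
    ultimately have "2 * card (E k \<inter> E i) = 1"
      by linarith
    then show False
      by presburger
  qed
  \<comment> \<open>Ten blocks besides \<open>i0\<close> and ten pairs in a 5-set: injectivity makes
    every pair a trace, and \<open>J\<close> inverts the correspondence.\<close>
  have "E ` (I - {i0}) = {e. e \<subseteq> B i0 \<and> card e = 2}"
  proof (rule card_seteq)
    show "finite {e. e \<subseteq> B i0 \<and> card e = 2}"
      using finB[OF i0] by simp
    show "E ` (I - {i0}) \<subseteq> {e. e \<subseteq> B i0 \<and> card e = 2}"
      using E by auto
    have "card {e. e \<subseteq> B i0 \<and> card e = 2} = 10"
      unfolding n_subsets[OF finB[OF i0]] B(2)[OF i0] by (simp add: numeral_eq_Suc)
    then show "card {e. e \<subseteq> B i0 \<and> card e = 2} \<le> card (E ` (I - {i0}))"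
      unfolding card_image[OF inj] using I i0 by simp
  qed
  then have "\<forall>e. e \<subseteq> B i0 \<and> card e = 2 \<longrightarrow> (\<exists>i \<in> I - {i0}. E i = e)"
    by (metis (mono_tags, lifting) imageE mem_Collect_eq)
  then obtain J where J: "\<And>e. e \<subseteq> B i0 \<Longrightarrow> card e = 2 \<Longrightarrow> J e \<in> I - {i0} \<and> E (J e) = e"
    by metis
  obtain q1 q2 a b c x y z where q: "{q1, q2} = {p1, p2}" and dX: "distinct [a, b, c, x, y, z]" "X = {a, b, c, x, y, z}"
    and T: "R (J {q1, q2}) = {a, b, c}" "R (J {p3, p4}) = {a, b, z}" "R (J {p3, p5}) = {a, c, y}" "R (J {p4, p5}) = {b, c, x}"
    "R (J {q1, p3}) = {b, x, y}" "R (J {q2, p3}) = {c, x, z}" "R (J {q1, p4}) = {c, y, z}" "R (J {q2, p4}) = {a, x, y}"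
    "R (J {q1, p5}) = {a, x, z}" "R (J {q2, p5}) = {b, y, z}"
  proof (rule triple_system_unique[OF d X, of "\<lambda>e. R (J e)"])
    fix e assume "e \<subseteq> {p1, p2, p3, p4, p5}" "card e = 2"
    then show "R (J e) \<subseteq> X \<and> card (R (J e)) = 3"
      using J[of e] R[of "J e"] unfolding B0 by blast
  next
    fix e f assume "e \<subseteq> {p1, p2, p3, p4, p5}" "card e = 2" "f \<subseteq> {p1, p2, p3, p4, p5}" "card f = 2" "e \<noteq> f"
    then have *: "J e \<in> I - {i0}" "J f \<in> I - {i0}" "E (J e) = e" "E (J f) = f" "e \<noteq> f"
      using J[of e] J[of f] unfolding B0 by blast+
    then have "J e \<noteq> J f"
      by metis
    then show "card (R (J e) \<inter> R (J f)) + card (e \<inter> f) = 2"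
      using ER[of "J e" "J f"] * by simp
  qed blast
  have dq: "distinct [q1, q2, p3, p4, p5]" and Q: "{q1, q2, p3, p4, p5} = B i0"
    using q d unfolding B0 by (auto simp: doubleton_eq_iff)
  have J_edge: "J {p, q} \<in> I - {i0}" "E (J {p, q}) = {p, q}" if "p \<in> B i0" "q \<in> B i0" "p \<noteq> q" for p q
    using J[of "{p, q}"] that by auto
  have mem: "q1 \<in> B i0" "q2 \<in> B i0" "p3 \<in> B i0" "p4 \<in> B i0" "p5 \<in> B i0"
    unfolding Q[symmetric] by auto
  have ne: "q1 \<noteq> q2" "q1 \<noteq> p3" "q1 \<noteq> p4" "q1 \<noteq> p5" "q2 \<noteq> p3" "q2 \<noteq> p4" "q2 \<noteq> p5" "p3 \<noteq> p4" "p3 \<noteq> p5" "p4 \<noteq> p5"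
    using dq by auto
  \<comment> \<open>The orders match \<open>biplane_blocks\<close>: positions 0 to 4 of
    \<open>ps\<close> are the points of \<open>B i0\<close>, positions 5 to 10 are
    \<open>a, b, c, x, y, z\<close>.\<close>
  define es where "es = [{q1, q2}, {p3, p4}, {p3, p5}, {p4, p5}, {q1, p3}, {q2, p3}, {q1, p4}, {q2, p4}, {q1, p5}, {q2, p5}]"
  define ps where "ps = [q1, q2, p3, p4, p5, a, b, c, x, y, z]"
  have es: "J e \<in> I - {i0}" "E (J e) = e" if "e \<in> set es" for e
    using that J_edge mem ne unfolding es_def by auto
  have "distinct es"
    unfolding es_def using ne not_sym[OF ne(1)] by (simp add: doubleton_eq_iff)
  moreover have "inj_on J (set es)"
    using es(2) by (metis inj_onI)
  ultimately have d_ls: "distinct (i0 # map J es)"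
    using es(1) by (auto simp: distinct_map)
  have set_ls: "set (i0 # map J es) = I"
  proof (rule card_seteq)
    show "set (i0 # map J es) \<subseteq> I"
      using es(1) i0 by auto
    show "card I \<le> card (set (i0 # map J es))"
      unfolding distinct_card[OF d_ls] I by (simp add: es_def)
  qed (use fin in auto)
  have set_ps: "set ps = P"
  proof -
    have "set ps = B i0 \<union> X"
      unfolding ps_def Q[symmetric] dX by auto
    then show ?thesis
      unfolding X_def using B(1)[OF i0] by auto
  qed
  have d_ps: "distinct ps"
    using set_ps P by (intro card_distinct) (simp add: ps_def)
  have B_eq: "B i = E i \<union> R i" for i
    unfolding E_def R_def by auto
  have "B i0 = {q1, q2, p3, p4, p5}"
    using Q by simp
  moreover have "map (\<lambda>e. B (J e)) es = map (\<lambda>e. e \<union> R (J e)) es"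
    using es(2) B_eq by (metis (no_types, lifting) list.map_cong0)
  ultimately have "map B (i0 # map J es) = {q1, q2, p3, p4, p5} # map (\<lambda>e. e \<union> R (J e)) es"
    by (simp add: comp_def)
  also have "\<dots> = map (\<lambda>b. set (map ((!) ps) b)) biplane_blocks"
    unfolding es_def biplane_blocks_def ps_def by (simp add: T, simp add: insert_commute)
  finally show ?thesis
    using that[OF d_ls set_ls d_ps set_ps] by blast
qed

section \<open>The extended Golay code\<close>

definition word_poly :: "(nat \<Rightarrow> bit) \<Rightarrow> bit poly"
  where "word_poly x = (\<Sum>i = 1..23. monom (x i) (i - 1))"

lemma extended_golay_iff:
  "x \<in> extended_golay \<longleftrightarrow>
    x \<in> binary_vectors 24 \<and> golay_generator dvd word_poly x \<and> (\<Sum>i = 1..24. x i) = 0"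
  unfolding extended_golay_def word_poly_def by simp

lemma coeff_word_poly: "coeff (word_poly x) k = (if k < 23 then x (Suc k) else 0)"
proof -
  have "coeff (word_poly x) k = (\<Sum>i = 1..23. if i - 1 = k then x i else 0)"
    unfolding word_poly_def by (simp add: coeff_sum)
  also have "\<dots> = (\<Sum>i = 1..23. if i = Suc k then x i else 0)"
    by (rule sum.cong) auto
  also have "\<dots> = (if k < 23 then x (Suc k) else 0)"
    by (subst sum.delta) auto
  finally show ?thesis .
qed

lemma word_poly_eq_Poly: "word_poly x = Poly (map x [1..<24])"
  by (rule poly_eqI) (auto simp: coeff_word_poly coeff_Poly_eq nth_default_def)

lemma word_poly_add: "word_poly (\<lambda>i\<in>{1..24}. x i + y i) = word_poly x + word_poly y"
proof (rule poly_eqI)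
  fix k
  show "coeff (word_poly (\<lambda>i\<in>{1..24}. x i + y i)) k = coeff (word_poly x + word_poly y) k"
  proof (cases "k < 23")
    case True
    have "(\<lambda>i\<in>{1..24}. x i + y i) (Suc k) = x (Suc k) + y (Suc k)"
      by (rule restrict_apply') (use True in simp)
    then show ?thesis
      unfolding coeff_add coeff_word_poly by (simp only: True if_True)
  next
    case False
    then show ?thesis
      unfolding coeff_add coeff_word_poly by (simp only: if_False add_0_left)
  qed
qed

lemma extended_golay_add:
  assumes "x \<in> extended_golay" "y \<in> extended_golay"
  shows "(\<lambda>i\<in>{1..24}. x i + y i) \<in> extended_golay"
proof -
  have "(\<Sum>i = 1..24. (\<lambda>i\<in>{1..24}. x i + y i) i) = (\<Sum>i = 1..24. x i + y i)"
    by (rule sum.cong) auto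
  also have "\<dots> = (\<Sum>i = 1..24. x i) + (\<Sum>i = 1..24. y i)"
    by (rule sum.distrib)
  also have "\<dots> = 0"
    using assms unfolding extended_golay_iff by (simp only: add_0_left)
  finally have parity: "(\<Sum>i = 1..24. (\<lambda>i\<in>{1..24}. x i + y i) i) = 0" .
  have "golay_generator dvd word_poly x + word_poly y"
    by (rule dvd_add) (use assms in \<open>simp_all only: extended_golay_iff\<close>)
  moreover have "(\<lambda>i\<in>{1..24}. x i + y i) \<in> binary_vectors 24"
    unfolding binary_vectors_def by auto
  ultimately show ?thesis
    unfolding extended_golay_iff word_poly_add using parity by blast
qed

lemma finite_extended_golay: "finite extended_golay"
  unfolding extended_golay_def using finite_binary_vectors by simp

lemma degree_golay_generator: "degree golay_generator = 11"
  unfolding golay_generator_def by simp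

text \<open>The coefficients of degree 11 to 22 determine a word: two words agreeing there differ by
  a multiple of the generator of degree at most 10, hence zero, and parity then fixes coordinate
  24.\<close>

lemma card_extended_golay_le: "card extended_golay \<le> 4096"
proof -
  have "inj_on (\<lambda>x. restrict x {12..23}) extended_golay"
  proof (rule inj_onI)
    fix x y assume x: "x \<in> extended_golay" and y: "y \<in> extended_golay"
      and eq: "restrict x {12..23} = restrict y {12..23}"
    have agree: "x i = y i" if "i \<in> {12..23}" for i
      using fun_cong[OF eq, of i] that by simp
    let ?d = "word_poly x - word_poly y"
    have "?d = 0"
    proof (rule ccontr)
      assume "?d \<noteq> 0"
      moreover have "golay_generator dvd ?d"
        using x y unfolding extended_golay_iff by (auto intro: dvd_diff)
      ultimately have "11 \<le> degree ?d"
        using dvd_imp_degree_le degree_golay_generator by metis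
      moreover have "degree ?d \<le> 10"
        by (rule degree_le) (use agree in \<open>auto simp: coeff_word_poly\<close>)
      ultimately show False
        by simp
    qed
    then have "coeff (word_poly x) k = coeff (word_poly y) k" for k
      by simp
    then have low: "x (Suc k) = y (Suc k)" if "k < 23" for k
      using that unfolding coeff_word_poly by (metis (full_types))
    have low': "x i = y i" if "i \<in> {1..23}" for i
    proof -
      obtain k where "i = Suc k" "k < 23"
        using \<open>i \<in> {1..23}\<close> by (cases i) auto
      then show ?thesis
        using low by blast
    qed
    have split24: "{1..24} = insert 24 {1..23 :: nat}"
      by auto
    then have sum24: "(\<Sum>i = 1..24. u i) = u 24 + (\<Sum>i = 1..23. u i)" for u :: "nat \<Rightarrow> bit"
      by simp
    have "(\<Sum>i = 1..23. x i) = (\<Sum>i = 1..23. y i)"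
      using low' by (intro sum.cong) auto
    moreover have "x 24 + (\<Sum>i = 1..23. x i) = y 24 + (\<Sum>i = 1..23. y i)"
      using x y unfolding extended_golay_iff sum24 by metis
    ultimately have "x 24 = y 24"
      by (simp only: add_right_cancel)
    then have "x i = y i" if "i \<in> {1..24}" for i
      using low'[of i] that unfolding split24 by blast
    then show "x = y"
      using PiE_ext[of x "{1..24}" "\<lambda>_. UNIV" y] x y
      unfolding extended_golay_iff binary_vectors_def by blast
  qed
  moreover have "(\<lambda>x. restrict x {12..23}) ` extended_golay \<subseteq> {12..23} \<rightarrow>\<^sub>E UNIV"
    by auto
  ultimately have "card extended_golay \<le> card ({12..23 :: nat} \<rightarrow>\<^sub>E (UNIV :: bit set))"
    by (intro card_inj_on_le) (auto intro!: finite_PiE simp: UNIV_bit)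
  also have "\<dots> = 4096"
    by (simp add: card_PiE card_UNIV_bit)
  finally show ?thesis .
qed

text \<open>Membership by certificate: \<open>p\<close> is an explicit quotient by the generator, so
  concrete words are checked by evaluation. \<open>take 23\<close> removes the parity
  coordinate.\<close>

lemma extended_golayI:
  assumes "x \<in> binary_vectors 24" "map x [1..<25] = bs" "Poly (take 23 bs) = golay_generator * p" "sum_list bs = 0"
  shows "x \<in> extended_golay"
proof -
  have "map x [1..<24] = take 23 bs"
    unfolding assms(2)[symmetric] by (simp add: take_map)
  moreover have "(\<Sum>i = 1..24. x i) = sum_list bs"
  proof -
    have "sum_list bs = sum x (set [1..<25])"
      unfolding assms(2)[symmetric] by (rule sum_list_distinct_conv_sum_set) simp
    moreover have "set [1..<25] = {1..24}"
      by auto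
    ultimately show ?thesis
      by simp
  qed
  ultimately show ?thesis
    using assms(1,3,4) unfolding extended_golay_iff word_poly_eq_Poly by simp
qed

text \<open>A labelling of the Golay code by a dodecad, found by computer search. Entry \<open>i - 1\<close> is the label of
  coordinate \<open>i\<close>: labels below 11 are the points of the biplane, 11 to 21 its blocks, and 22 and 23 the
  two base points, 23 being the one in the dodecad.\<close>

definition golay_positions :: "nat list"
  where "golay_positions = [23, 22, 0, 1, 2, 15, 6, 3, 9, 7, 4, 5, 11, 10, 8, 17, 14, 18, 13, 20, 16, 19, 12, 21]"

lemma length_golay_positions: "length golay_positions = 24"
  by (simp add: golay_positions_def)

text \<open>\<open>V\<close> is a set of labels rather than of coordinates.\<close>

definition golay_word :: "nat set \<Rightarrow> nat \<Rightarrow> bit"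
  where "golay_word V = (\<lambda>i\<in>{1..24}. if golay_positions ! (i - 1) \<in> V then 1 else 0)"

lemma map_golay_word:
  "map (golay_word V) [1..<25] = map (\<lambda>j. if j \<in> V then 1 else 0) golay_positions"
proof (rule nth_equalityI)
  fix i assume "i < length (map (golay_word V) [1..<25])"
  then show "map (golay_word V) [1..<25] ! i = map (\<lambda>j. if j \<in> V then 1 else 0) golay_positions ! i"
    by (simp add: golay_word_def length_golay_positions)
qed (simp add: length_golay_positions)

lemma golay_word_mem: "golay_word V \<in> binary_vectors 24"
  unfolding golay_word_def binary_vectors_def by auto

lemma golay_word_symdiff:
  assumes "golay_word V \<in> extended_golay" "golay_word W \<in> extended_golay"
  shows "golay_word (V - W \<union> (W - V)) \<in> extended_golay"
proof -
  have "golay_word (V - W \<union> (W - V)) = (\<lambda>i\<in>{1..24}. golay_word V i + golay_word W i)"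
    by (auto simp: golay_word_def fun_eq_iff)
  then show ?thesis
    using extended_golay_add[OF assms] by simp
qed

lemma golay_word_empty: "golay_word {} \<in> extended_golay"
proof (rule extended_golayI[OF golay_word_mem map_golay_word, where p = 0])
qed (simp_all add: golay_positions_def)

lemma golay_word_points: "golay_word (insert 23 {..<11}) \<in> extended_golay"
  by (rule extended_golayI[OF golay_word_mem map_golay_word, where p = "[:1,0,0,1:]"])
    (simp_all add: golay_positions_def golay_generator_def)

text \<open>The octads through both base points: such a word consists of one block label, 22 and 23,
  and the five points of that block.\<close>

lemma golay_word_blocks:
  assumes "k < 11"
  shows "golay_word ({11 + k, 22, 23} \<union> set (biplane_blocks ! k)) \<in> extended_golay"
proof -
  note I = extended_golayI[OF golay_word_mem map_golay_word]
  have b0: "golay_word ({11 + 0, 22, 23} \<union> set (biplane_blocks ! 0)) \<in> extended_golay"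
    by (rule I[where p = "[:1, 1:]"])
      (simp_all add: golay_positions_def golay_generator_def biplane_blocks_def)
  have b1: "golay_word ({11 + 1, 22, 23} \<union> set (biplane_blocks ! 1)) \<in> extended_golay"
    by (rule I[where p = "[:1, 1, 0, 0, 1, 0, 0, 1, 1, 1, 1, 1:]"])
      (simp_all add: golay_positions_def golay_generator_def biplane_blocks_def)
  have b2: "golay_word ({11 + 2, 22, 23} \<union> set (biplane_blocks ! 2)) \<in> extended_golay"
    by (rule I[where p = "[:1, 1, 1, 1, 1, 1, 1, 1:]"])
      (simp_all add: golay_positions_def golay_generator_def biplane_blocks_def)
  have b3: "golay_word ({11 + 3, 22, 23} \<union> set (biplane_blocks ! 3)) \<in> extended_golay"
    by (rule I[where p = "[:1, 1, 1, 1, 1, 1:]"])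
      (simp_all add: golay_positions_def golay_generator_def biplane_blocks_def)
  have b4: "golay_word ({11 + 4, 22, 23} \<union> set (biplane_blocks ! 4)) \<in> extended_golay"
    by (rule I[where p = "[:1, 1, 1, 1:]"])
      (simp_all add: golay_positions_def golay_generator_def biplane_blocks_def)
  have b5: "golay_word ({11 + 5, 22, 23} \<union> set (biplane_blocks ! 5)) \<in> extended_golay"
    by (rule I[where p = "[:1, 1, 0, 1, 0, 1, 1, 1, 1, 1:]"])
      (simp_all add: golay_positions_def golay_generator_def biplane_blocks_def)
  have b6: "golay_word ({11 + 6, 22, 23} \<union> set (biplane_blocks ! 6)) \<in> extended_golay"
    by (rule I[where p = "[:1, 1, 1, 0, 1:]"])
      (simp_all add: golay_positions_def golay_generator_def biplane_blocks_def)
  have b7: "golay_word ({11 + 7, 22, 23} \<union> set (biplane_blocks ! 7)) \<in> extended_golay"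
    by (rule I[where p = "[:1, 1, 0, 1, 1, 1, 1:]"])
      (simp_all add: golay_positions_def golay_generator_def biplane_blocks_def)
  have b8: "golay_word ({11 + 8, 22, 23} \<union> set (biplane_blocks ! 8)) \<in> extended_golay"
    by (rule I[where p = "[:1, 1, 1, 0, 0, 0, 1, 1, 1, 1, 1:]"])
      (simp_all add: golay_positions_def golay_generator_def biplane_blocks_def)
  have b9: "golay_word ({11 + 9, 22, 23} \<union> set (biplane_blocks ! 9)) \<in> extended_golay"
    by (rule I[where p = "[:1, 1, 0, 1, 1, 1, 1, 1, 1:]"])
      (simp_all add: golay_positions_def golay_generator_def biplane_blocks_def)
  have b10: "golay_word ({11 + 10, 22, 23} \<union> set (biplane_blocks ! 10)) \<in> extended_golay"
    by (rule I[where p = "[:1, 1, 1:]"])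
      (simp_all add: golay_positions_def golay_generator_def biplane_blocks_def)
  have "k \<in> {0, 1, 2, 3, 4, 5, 6, 7, 8, 9, 10}"
    using assms by (simp, presburger)
  then show ?thesis
    using b0 b1 b2 b3 b4 b5 b6 b7 b8 b9 b10 by (elim insertE emptyE) simp_all
qed

section \<open>Codes with the parameters of the extended Golay code\<close>

lemma card_sym_diff:
  assumes "finite A" "finite B"
  shows "card (sym_diff A B) + 2 * card (A \<inter> B) = card A + card B"
proof -
  have "card (sym_diff A B) = card (A - B) + card (B - A)"
    using assms by (intro card_Un_disjoint) auto
  moreover have "card A = card (A - B) + card (A \<inter> B)" "card B = card (B - A) + card (A \<inter> B)"
    using assms card_Int_Diff[of A B] card_Int_Diff[of B A] by (simp_all add: Int_commute)
  ultimately show ?thesis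
    by simp
qed

lemma even_card_sym_diff:
  assumes "finite A" "finite B"
  shows "even (card (sym_diff A B)) \<longleftrightarrow> (even (card A) \<longleftrightarrow> even (card B))"
proof -
  have "even (card (sym_diff A B) + 2 * card (A \<inter> B)) \<longleftrightarrow> even (card A + card B)"
    unfolding card_sym_diff[OF assms] ..
  then show ?thesis
    by simp
qed

lemma even_card_Int_sym_diff:
  assumes "finite U"
  shows "even (card (U \<inter> sym_diff V W)) \<longleftrightarrow> (even (card (U \<inter> V)) \<longleftrightarrow> even (card (U \<inter> W)))"
proof -
  have "U \<inter> sym_diff V W = sym_diff (U \<inter> V) (U \<inter> W)"
    by blast
  then show ?thesis
    using even_card_sym_diff[of "U \<inter> V" "U \<inter> W"] assms by simp
qed

text \<open>Toggling a point of \<open>W\<close> in \<open>v\<close> reverses the sign, so the terms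
  cancel in pairs.\<close>

lemma sum_character:
  assumes X: "finite X" and W: "W \<subseteq> X"
  shows "(\<Sum>v\<in>Pow X. (- 1) ^ card (W \<inter> v) :: int) = (if W = {} then 2 ^ card X else 0)"
proof (cases "W = {}")
  case True
  then show ?thesis
    using X by (simp add: card_Pow)
next
  case False
  then obtain x where x: "x \<in> W"
    by blast
  have fin: "finite W"
    using X W finite_subset by blast
  have flip: "(- 1) ^ card (W \<inter> sym_diff v {x}) = - ((- 1) ^ card (W \<inter> v) :: int)" for v
    using even_card_Int_sym_diff[OF fin, of v "{x}"] x by (simp add: minus_one_power_iff)
  have "(\<Sum>v\<in>Pow X. (- 1) ^ card (W \<inter> v) :: int) = (\<Sum>v\<in>Pow X. (- 1) ^ card (W \<inter> sym_diff v {x}))"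
  proof (rule sum.reindex_bij_witness[where i = "\<lambda>v. sym_diff v {x}" and j = "\<lambda>v. sym_diff v {x}"])
    fix v
    have involution: "sym_diff (sym_diff v {x}) {x} = v"
      by blast
    show "sym_diff (sym_diff v {x}) {x} = v" "sym_diff (sym_diff v {x}) {x} = v"
      by (fact involution)+
    show "(- 1) ^ card (W \<inter> sym_diff (sym_diff v {x}) {x}) = ((- 1) ^ card (W \<inter> v) :: int)"
      unfolding involution ..
  qed (use x W in auto)
  also have "\<dots> = - (\<Sum>v\<in>Pow X. (- 1) ^ card (W \<inter> v))"
    unfolding flip sum_negf ..
  finally show ?thesis
    using False by simp
qed

text \<open>The Fourier coefficient of the indicator function of \<open>F\<close> has absolute value \<open>card F\<close> at every
  point of the dual, so the bound is Parseval's identity.\<close>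

lemma card_dual_le:
  assumes X: "finite X" and F: "F \<subseteq> Pow X" "F \<noteq> {}"
  shows "card {v \<in> Pow X. \<forall>u\<in>F. even (card (u \<inter> v))} * card F \<le> 2 ^ card X"
proof -
  let ?D = "{v \<in> Pow X. \<forall>u\<in>F. even (card (u \<inter> v))}"
  define f where "f = (\<lambda>v. \<Sum>u\<in>F. (- 1) ^ card (u \<inter> v) :: int)"
  have finF: "finite F"
    using F X finite_subset by blast
  have fin: "finite u" if "u \<in> F" for u
    using that F X finite_subset by blast
  have "(\<Sum>v\<in>?D. f v ^ 2) = (\<Sum>v\<in>?D. int (card F) ^ 2)"
    by (rule sum.cong) (auto simp: f_def)
  then have "int (card ?D) * int (card F) ^ 2 = (\<Sum>v\<in>?D. f v ^ 2)"
    by simp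
  also have "\<dots> \<le> (\<Sum>v\<in>Pow X. f v ^ 2)"
    by (rule sum_mono2) (use X in auto)
  also have "\<dots> = (\<Sum>v\<in>Pow X. \<Sum>u\<in>F. \<Sum>w\<in>F. (- 1) ^ card (sym_diff u w \<inter> v))"
  proof (rule sum.cong)
    fix v
    have "(- 1) ^ card (u \<inter> v) * (- 1) ^ card (w \<inter> v) = ((- 1) ^ card (sym_diff u w \<inter> v) :: int)"
      if "u \<in> F" "w \<in> F" for u w
    proof -
      have "sym_diff u w \<inter> v = sym_diff (u \<inter> v) (w \<inter> v)"
        by blast
      then show ?thesis
        using even_card_sym_diff[of "u \<inter> v" "w \<inter> v"] fin that by (simp add: minus_one_power_iff)
    qed
    then show "f v ^ 2 = (\<Sum>u\<in>F. \<Sum>w\<in>F. (- 1) ^ card (sym_diff u w \<inter> v))"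
      unfolding f_def power2_eq_square sum_product by (intro sum.cong) auto
  qed simp
  also have "\<dots> = (\<Sum>u\<in>F. \<Sum>w\<in>F. \<Sum>v\<in>Pow X. (- 1) ^ card (sym_diff u w \<inter> v))"
    by (subst sum.swap) (intro sum.cong refl sum.swap)
  also have "\<dots> = (\<Sum>u\<in>F. \<Sum>w\<in>F. if u = w then 2 ^ card X else 0)"
  proof (intro sum.cong refl)
    fix u w assume "u \<in> F" "w \<in> F"
    then have "sym_diff u w \<subseteq> X" "sym_diff u w = {} \<longleftrightarrow> u = w"
      using F by blast+
    then show "(\<Sum>v\<in>Pow X. (- 1) ^ card (sym_diff u w \<inter> v)) = (if u = w then 2 ^ card X else 0 :: int)"
      using sum_character[OF X] by simp
  qed
  also have "\<dots> = int (card F) * 2 ^ card X"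
    using finF by simp
  finally have "(int (card ?D) * int (card F)) * int (card F) \<le> 2 ^ card X * int (card F)"
    by (simp add: power2_eq_square mult.assoc mult.commute)
  moreover have "int (card F) > 0"
    using finF F by (simp add: card_gt_0_iff)
  ultimately have "int (card ?D) * int (card F) \<le> 2 ^ card X"
    by (rule mult_right_le_imp_le)
  then have "int (card ?D * card F) \<le> int (2 ^ card X)"
    by simp
  then show ?thesis
    by (simp only: of_nat_le_iff)
qed

text \<open>A codeword has been translated to the empty set and words are sets of coordinates;
  \<open>R\<close> is a dodecad. Closure under symmetric difference is derived, from
  \<open>F_eq_dual\<close>.\<close>

locale golay_parameters =
  fixes X :: "'a set" and F :: "'a set set" and R :: "'a set"
  assumes card_X: "card X = 24" and F_sub: "F \<subseteq> Pow X" and empty_mem: "{} \<in> F" and card_F: "card F = 4096"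
    and distances: "\<And>u v. u \<in> F \<Longrightarrow> v \<in> F \<Longrightarrow> card (sym_diff u v) \<in> {0, 8, 12, 16, 24}"
    and R: "R \<in> F" "card R = 12"
begin

lemma fin_X: "finite X"
  using card_X by (auto intro: card_ge_0_finite)

lemma fin: "u \<in> F \<Longrightarrow> finite u"
  using F_sub fin_X finite_subset by blast

lemma sub_X: "u \<in> F \<Longrightarrow> u \<subseteq> X"
  using F_sub by blast

lemma weights: "u \<in> F \<Longrightarrow> card u \<in> {0, 8, 12, 16, 24}"
  using distances[of u "{}"] empty_mem by simp

text \<open>All weights and distances are multiples of 4, and weights and distance together give
  twice the intersection size.\<close>

lemma even_Int:
  assumes "u \<in> F" "v \<in> F"
  shows "even (card (u \<inter> v))"
proof -
  have "card (sym_diff u v) + 2 * card (u \<inter> v) = card u + card v"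
    using card_sym_diff fin assms by blast
  moreover have "4 dvd card (sym_diff u v)" "4 dvd card u" "4 dvd card v"
    using distances[OF assms] weights[OF assms(1)] weights[OF assms(2)] by auto
  ultimately have "4 dvd 2 * card (u \<inter> v)"
    by (metis dvd_add dvd_add_right_iff)
  then show ?thesis
    by presburger
qed

lemma F_eq_dual: "F = {v \<in> Pow X. \<forall>u\<in>F. even (card (u \<inter> v))}"
proof (rule card_seteq)
  show "finite {v \<in> Pow X. \<forall>u\<in>F. even (card (u \<inter> v))}"
    using fin_X by simp
  show "F \<subseteq> {v \<in> Pow X. \<forall>u\<in>F. even (card (u \<inter> v))}"
    using even_Int F_sub by blast
  show "card {v \<in> Pow X. \<forall>u\<in>F. even (card (u \<inter> v))} \<le> card F"
    using card_dual_le[OF fin_X F_sub] empty_mem unfolding card_F card_X by auto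
qed

lemma sym_diff_mem:
  assumes "v \<in> F" "w \<in> F"
  shows "sym_diff v w \<in> F"
proof -
  have "\<forall>u\<in>F. even (card (u \<inter> sym_diff v w))"
    using even_card_Int_sym_diff fin even_Int assms by blast
  moreover have "sym_diff v w \<subseteq> X"
    using assms sub_X by blast
  ultimately show ?thesis
    using F_eq_dual by blast
qed

lemma complement_mem: "X - R \<in> F"
proof -
  have "even (card (u \<inter> X))" if "u \<in> F" for u
    using weights[OF that] sub_X[OF that] by (auto simp: Int_absorb2)
  then have "X \<in> F"
    using F_eq_dual by blast
  then have "sym_diff X R \<in> F"
    using sym_diff_mem R by blast
  moreover have "sym_diff X R = X - R"
    using sub_X R by blast
  ultimately show ?thesis
    by simp
qed

text \<open>An octad inside \<open>R\<close> would be at distance 4 from \<open>R\<close>.\<close>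

lemma subset_R:
  assumes "v \<in> F" "v \<subseteq> R"
  shows "v = {} \<or> v = R"
proof -
  have "card v \<le> 12"
    using assms R fin card_mono by metis
  moreover have "card (sym_diff v R) + 2 * card v = card v + 12"
    using card_sym_diff[of v R] fin assms R by (simp add: Int_absorb2)
  moreover have "card (sym_diff v R) \<in> {0, 8, 12, 16, 24}"
    using distances assms R by blast
  ultimately have "card v = 0 \<or> card v = 12"
    using weights[OF assms(1)] by auto
  then show ?thesis
    using assms R fin card_subset_eq[of R v] by auto
qed

text \<open>The complement of \<open>R\<close> is a word, so \<open>v\<close> meets it evenly and
  cannot contain \<open>l\<close> alone.\<close>

lemma subset_insert_R:
  assumes "v \<in> F" "v - {l} \<subseteq> R" "l \<in> X - R"
  shows "v = {} \<or> v = R"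
proof -
  have "even (card (v \<inter> (X - R)))"
    using even_Int complement_mem assms by blast
  moreover have "v \<inter> (X - R) = (if l \<in> v then {l} else {})"
    using assms by auto
  ultimately have "l \<notin> v"
    by (auto split: if_splits)
  then show ?thesis
    using subset_R assms by blast
qed

text \<open>Half of the words contain \<open>r\<close>, and they are told apart by their traces on the 11 points of
  \<open>X - R - {l}\<close>; so each of the \<open>2^11\<close> traces occurs.\<close>

lemma trace_surj:
  assumes l: "l \<in> X - R" and r: "r \<in> R" and K: "K \<subseteq> X - R - {l}"
  obtains w where "w \<in> F" "r \<in> w" "w \<inter> (X - R - {l}) = K"
proof -
  define F0 where "F0 = {c \<in> F. r \<in> c}"
  let ?L = "X - R - {l}"
  have finF: "finite F"
    using card_F by (auto intro: card_ge_0_finite)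
  have inj: "inj_on (\<lambda>c. c \<inter> ?L) F0"
  proof (rule inj_onI)
    fix c d assume c: "c \<in> F0" and d: "d \<in> F0" and eq: "c \<inter> ?L = d \<inter> ?L"
    have "sym_diff c d \<in> F"
      using c d sym_diff_mem unfolding F0_def by blast
    moreover have "sym_diff c d - {l} \<subseteq> R"
      using eq c d sub_X unfolding F0_def by blast
    ultimately have "sym_diff c d = {} \<or> sym_diff c d = R"
      using subset_insert_R l by blast
    moreover have "r \<notin> sym_diff c d"
      using c d unfolding F0_def by blast
    ultimately show "c = d"
      using r by blast
  qed
  have "F \<subseteq> F0 \<union> (\<lambda>c. sym_diff c R) ` F0"
  proof
    fix c assume c: "c \<in> F"
    show "c \<in> F0 \<union> (\<lambda>c. sym_diff c R) ` F0"
    proof (cases "r \<in> c")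
      case False
      then have "sym_diff c R \<in> F0"
        using c r sym_diff_mem R unfolding F0_def by blast
      moreover have "c = sym_diff (sym_diff c R) R"
        by blast
      ultimately show ?thesis
        by blast
    qed (use c in \<open>simp add: F0_def\<close>)
  qed
  then have "card F \<le> card (F0 \<union> (\<lambda>c. sym_diff c R) ` F0)"
    using finF by (intro card_mono) (auto simp: F0_def)
  also have "\<dots> \<le> card F0 + card ((\<lambda>c. sym_diff c R) ` F0)"
    by (rule card_Un_le)
  also have "\<dots> \<le> card F0 + card F0"
    using finF by (intro add_left_mono card_image_le) (simp add: F0_def)
  finally have F0: "card F0 \<ge> 2048"
    unfolding card_F by simp
  have "card ?L = 11"
    using l R sub_X[OF R(1)] fin[OF R(1)] fin_X card_X by (simp add: card_Diff_subset)
  then have "card (Pow ?L) = 2048"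
    using fin_X by (simp add: card_Pow)
  then have "(\<lambda>c. c \<inter> ?L) ` F0 = Pow ?L"
    using F0 fin_X card_image[OF inj] by (intro card_seteq) auto
  then have "K \<in> (\<lambda>c. c \<inter> ?L) ` F0"
    using K by blast
  then show ?thesis
    using that unfolding F0_def by blast
qed

text \<open>With \<open>k\<close> points in \<open>R\<close> the word has weight
  \<open>k + 2\<close> and distance \<open>14 - k\<close> from \<open>R\<close>; both are admissible
  only for \<open>k = 6\<close>.\<close>

lemma weight_eight:
  assumes w: "w \<in> F" "card (w \<inter> (X - R)) = 2"
  shows "card (w \<inter> R) = 6"
proof -
  have "card w = card (w \<inter> R) + card (w - R)"
    using card_Int_Diff fin w by blast
  moreover have "w - R = w \<inter> (X - R)"
    using sub_X w by blast
  ultimately have cw: "card w = card (w \<inter> R) + 2"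
    using w by simp
  have "card (w \<inter> R) \<le> 12"
    using R fin card_mono[of R "w \<inter> R"] by auto
  moreover have "card (sym_diff w R) + 2 * card (w \<inter> R) = card w + 12"
    using card_sym_diff fin w R by metis
  moreover have "card (sym_diff w R) \<in> {0, 8, 12, 16, 24}"
    using distances w R by blast
  ultimately show ?thesis
    using weights[OF w(1)] cw by auto
qed

end

section \<open>The biplane in a dodecad and the resulting labelling\<close>

lemma mem_nth_image_iff:
  assumes "distinct vs" "V \<subseteq> {..<length vs}" "j < length vs"
  shows "vs ! j \<in> (!) vs ` V \<longleftrightarrow> j \<in> V"
  using assms by (auto simp: nth_eq_iff_index_eq)

context golay_parameters
begin

text \<open>A word with trace \<open>{i}\<close> away from \<open>l\<close> exists, and meeting the
  complement of \<open>R\<close> evenly forces it through \<open>l\<close>.\<close>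

lemma pair_word:
  assumes l: "l \<in> X - R" and r: "r \<in> R" and i: "i \<in> X - R - {l}"
  obtains w where "w \<in> F" "r \<in> w" "w \<inter> (X - R) = {i, l}"
proof -
  obtain w where w: "w \<in> F" "r \<in> w" "w \<inter> (X - R - {l}) = {i}"
    using trace_surj[OF l r, of "{i}"] i by auto
  have "even (card (w \<inter> (X - R)))"
    using even_Int w complement_mem by blast
  moreover have "w \<inter> (X - R) = (if l \<in> w then {i, l} else {i})"
    using w(3) l by auto
  ultimately have "w \<inter> (X - R) = {i, l}"
    by (auto split: if_splits)
  then show ?thesis
    using that w by blast
qed

text \<open>The sum of the two words meets the complement of \<open>R\<close> in
  \<open>{i, j}\<close>, so it too has six points in \<open>R\<close>; then \<open>6 + 6 - 6\<close>
  is twice the intersection size.\<close>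

lemma pair_words_meet:
  assumes l: "l \<in> X - R" and r: "r \<in> R" and ij: "i \<in> X - R - {l}" "j \<in> X - R - {l}" "i \<noteq> j"
    and v: "v \<in> F" "r \<in> v" "v \<inter> (X - R) = {i, l}" and w: "w \<in> F" "r \<in> w" "w \<inter> (X - R) = {j, l}"
  shows "card (v \<inter> R \<inter> (w \<inter> R)) = 3"
proof -
  have S: "card (v \<inter> R) = 6" "card (w \<inter> R) = 6"
    using weight_eight v w ij by auto
  have finR: "finite R"
    using fin R by blast
  define d where "d = sym_diff v w"
  have d: "d \<in> F"
    unfolding d_def using sym_diff_mem v w by blast
  have "d \<inter> (X - R) = sym_diff (v \<inter> (X - R)) (w \<inter> (X - R))"
    unfolding d_def by blast
  also have "\<dots> = {i, j}"
    unfolding v w using ij by auto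
  finally have "card (d \<inter> (X - R)) = 2"
    using ij by simp
  then have "card (d \<inter> R) = 6"
    using weight_eight d by blast
  moreover have "d \<inter> R = sym_diff (v \<inter> R) (w \<inter> R)"
    unfolding d_def by blast
  ultimately show ?thesis
    using card_sym_diff[of "v \<inter> R" "w \<inter> R"] S finR by simp
qed

lemma golay_labelling:
  obtains vs where "distinct vs" "set vs = X" "length vs = 24"
    "\<And>c. c \<in> F \<Longrightarrow> golay_word {j. j < 24 \<and> vs ! j \<in> c} \<in> extended_golay"
proof -
  have finR: "finite R" and R_sub: "R \<subseteq> X"
    using fin R sub_X by blast+
  have "card (X - R) = 12"
    using finR R_sub card_X R by (simp add: card_Diff_subset)
  then obtain l where l: "l \<in> X - R"
    by (metis card.empty ex_in_conv zero_neq_numeral)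
  obtain r where r: "r \<in> R"
    using R by (metis card.empty ex_in_conv zero_neq_numeral)
  define I where "I = X - R - {l}"
  define P where "P = R - {r}"
  have cards: "card I = 11" "card P = 11"
    unfolding I_def P_def using l r \<open>card (X - R) = 12\<close> R by simp_all
  have "\<forall>i\<in>I. \<exists>w. w \<in> F \<and> r \<in> w \<and> w \<inter> (X - R) = {i, l}"
    using pair_word[OF l r] unfolding I_def by metis
  then obtain w where w: "\<And>i. i \<in> I \<Longrightarrow> w i \<in> F" "\<And>i. i \<in> I \<Longrightarrow> r \<in> w i" "\<And>i. i \<in> I \<Longrightarrow> w i \<inter> (X - R) = {i, l}"
    by metis
  \<comment> \<open>Removing the common point \<open>r\<close> from traces of size 6 that meet in 3
    leaves blocks of size 5 that meet in 2.\<close>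
  define B where "B = (\<lambda>i. w i \<inter> P)"
  have w_R: "w i \<inter> R = insert r (B i)" "r \<notin> B i" if "i \<in> I" for i
    using w(2)[OF that] r unfolding B_def P_def by auto
  have finB: "finite (B i)" for i
    unfolding B_def P_def using finR by simp
  have B_sub: "B i \<subseteq> P" for i
    unfolding B_def by blast
  have B_card: "card (B i) = 5" if i: "i \<in> I" for i
  proof -
    have "i \<noteq> l"
      using i unfolding I_def by blast
    then have "card (w i \<inter> R) = 6"
      using weight_eight[OF w(1)[OF i]] w(3)[OF i] by simp
    then show ?thesis
      unfolding w_R(1)[OF i] using w_R(2)[OF i] finB by simp
  qed
  have B_meet: "card (B i \<inter> B j) = 2" if ij: "i \<in> I" "j \<in> I" "i \<noteq> j" for i j
  proof -
    have "card (w i \<inter> R \<inter> (w j \<inter> R)) = 3"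
      by (rule pair_words_meet[OF l r]) (use ij w in \<open>auto simp: I_def\<close>)
    moreover have "insert r (B i) \<inter> insert r (B j) = insert r (B i \<inter> B j)"
      by blast
    ultimately show ?thesis
      unfolding w_R(1)[OF ij(1)] w_R(1)[OF ij(2)] using w_R(2)[OF ij(1)] finB by simp
  qed
  obtain ls ps where lists: "distinct ls" "set ls = I" "distinct ps" "set ps = P"
    and blocks: "map B ls = map (\<lambda>b. set (map ((!) ps) b)) biplane_blocks"
    by (rule biplane_unique[OF cards B_sub B_card B_meet])
  have len: "length ls = 11" "length ps = 11"
    using lists cards distinct_card[of ls] distinct_card[of ps] by simp_all
  \<comment> \<open>The order realises the label convention of \<open>golay_positions\<close>:
    points, blocks, then \<open>l\<close> as 22 and \<open>r\<close> as 23.\<close>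
  define vs where "vs = ps @ ls @ [l, r]"
  have len_vs: "length vs = 24"
    unfolding vs_def using len by simp
  have set_vs: "set vs = X"
    unfolding vs_def using lists l r R_sub unfolding I_def P_def by auto
  have d_vs: "distinct vs"
    using set_vs card_X len_vs by (intro card_distinct) simp
  have nth_vs: "vs ! j = ps ! j" if "j < 11" for j
    unfolding vs_def using that len by (simp add: nth_append)
  have nth_vs': "vs ! (11 + k) = ls ! k" if "k < 11" for k
    unfolding vs_def using that len by (simp add: nth_append)
  have nth_lr: "vs ! 22 = l" "vs ! 23 = r"
    unfolding vs_def using len by (simp_all add: nth_append)
  define pos where "pos = (\<lambda>c. {j. j < 24 \<and> vs ! j \<in> c})"
  have pos_image: "pos ((!) vs ` V) = V" if "V \<subseteq> {..<24}" for V
    unfolding pos_def using that mem_nth_image_iff[OF d_vs] len_vs by auto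
  have pos_sym_diff: "pos (sym_diff c d) = sym_diff (pos c) (pos d)" for c d
    unfolding pos_def by auto
  have golay_R: "golay_word (pos R) \<in> extended_golay"
  proof -
    have "(!) vs ` insert 23 {..<11} = insert r (set ps)"
      using nth_lr nth_vs len by (auto simp: set_conv_nth image_iff)
    also have "\<dots> = R"
      using lists r unfolding P_def by auto
    finally have "pos R = insert 23 {..<11}"
      using pos_image[of "insert 23 {..<11}"] by auto
    then show ?thesis
      using golay_word_points by simp
  qed
  have golay_w: "golay_word (pos (w i)) \<in> extended_golay" if i: "i \<in> I" for i
  proof -
    obtain k where k: "k < 11" "i = ls ! k"
      using i lists len by (metis in_set_conv_nth)
    let ?V = "{11 + k, 22, 23} \<union> set (biplane_blocks ! k)"
    have len_blocks: "length biplane_blocks = 11"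
      by (simp add: biplane_blocks_def)
    have "\<forall>b\<in>set biplane_blocks. set b \<subseteq> {..<11}"
      by (simp add: biplane_blocks_def)
    then have blk: "set (biplane_blocks ! k) \<subseteq> {..<11}"
      using k len_blocks nth_mem by metis
    have "map B ls ! k = map (\<lambda>b. set (map ((!) ps) b)) biplane_blocks ! k"
      unfolding blocks ..
    then have "B i = (!) ps ` set (biplane_blocks ! k)"
      using k len len_blocks by simp
    also have "\<dots> = (!) vs ` set (biplane_blocks ! k)"
      using blk nth_vs by (intro image_cong) auto
    finally have B_i: "B i = (!) vs ` set (biplane_blocks ! k)" .
    have "w i = w i \<inter> (X - R) \<union> w i \<inter> R"
      using sub_X[OF w(1)[OF i]] by blast
    also have "\<dots> = {i, l} \<union> insert r (B i)"
      unfolding w(3)[OF i] w_R(1)[OF i] ..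
    also have "\<dots> = (!) vs ` ?V"
      unfolding B_i using k nth_vs' nth_lr by auto
    finally have "w i = (!) vs ` ?V" .
    moreover have "?V \<subseteq> {..<24}"
      using k blk by auto
    ultimately have "pos (w i) = ?V"
      using pos_image by metis
    then show ?thesis
      using golay_word_blocks[OF k(1)] by simp
  qed
  \<comment> \<open>Adding \<open>w i\<close> removes exactly \<open>i\<close> from the trace on
    \<open>I\<close>. Words with empty trace on \<open>I\<close> are only the empty word and
    \<open>R\<close>.\<close>
  have golay: "golay_word (pos c) \<in> extended_golay" if "c \<in> F" for c
    using that
  proof (induction "card (c \<inter> I)" arbitrary: c rule: less_induct)
    case less
    show ?case
    proof (cases "c \<inter> I = {}")
      case True
      then have "c - {l} \<subseteq> R"
        using sub_X[OF less.prems] unfolding I_def by blast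
      then have "c = {} \<or> c = R"
        using subset_insert_R less.prems l by blast
      moreover have "pos {} = {}"
        unfolding pos_def by simp
      ultimately show ?thesis
        using golay_R golay_word_empty by metis
    next
      case False
      then obtain i where i: "i \<in> c" "i \<in> I"
        by blast
      let ?d = "sym_diff c (w i)"
      have "w i \<inter> I = {i}"
        using w(3)[OF i(2)] i unfolding I_def by blast
      then have "?d \<inter> I = c \<inter> I - {i}"
        using i(1) by (auto simp: set_eq_iff)
      then have "?d \<inter> I \<subset> c \<inter> I"
        using i by blast
      then have "card (?d \<inter> I) < card (c \<inter> I)"
        using fin[OF less.prems] by (intro psubset_card_mono) auto
      moreover have "?d \<in> F"
        using sym_diff_mem less.prems w i by blast
      ultimately have "golay_word (pos ?d) \<in> extended_golay"
        using less.hyps by blast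
      moreover have "pos c = sym_diff (pos ?d) (pos (w i))"
        unfolding pos_sym_diff by blast
      ultimately show ?thesis
        using golay_word_symdiff golay_w[OF i(2)] by metis
    qed
  qed
  show ?thesis
    using that[OF d_vs set_vs len_vs] golay unfolding pos_def by blast
qed

end

section \<open>Return from sets to codes over two symbols\<close>

lemma set_golay_positions: "set golay_positions = {..<24}"
  unfolding golay_positions_def by (simp add: lessThan_nat_numeral lessThan_Suc) auto

lemma golay_code_isomorphic:
  assumes C: "C \<subseteq> words 24 2" "card C = 4096"
    and dist: "\<And>c d. c \<in> C \<Longrightarrow> d \<in> C \<Longrightarrow> hamming_dist 24 c d \<in> {0, 8, 12, 16, 24}"
    and x: "x \<in> C" and y: "y \<in> C" "hamming_dist 24 x y = 12"
  shows "code_isomorphic 24 2 C (of_binary 24 extended_golay)"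
proof -
  define S where "S = (\<lambda>c. {i \<in> {1..24}. c i \<noteq> x i})"
  have symbol: "c i = 1 \<or> c i = 2" if "c \<in> C" "i \<in> {1..24}" for c i
  proof -
    have "c i \<in> {1..2}"
      using that C unfolding words_def by blast
    then show ?thesis
      by auto
  qed
  have S_diff: "sym_diff (S c) (S d) = {i \<in> {1..24}. c i \<noteq> d i}" if "c \<in> C" "d \<in> C" for c d
    unfolding S_def using symbol[OF that(1)] symbol[OF that(2)] symbol[OF x] by fastforce
  have inj: "inj_on S C"
  proof (rule inj_onI)
    fix c d assume cd: "c \<in> C" "d \<in> C" "S c = S d"
    then have "\<forall>i\<in>{1..24}. c i = d i"
      using S_diff[of c d] by auto
    then show "c = d"
      using PiE_ext[of c "{1..24}" "\<lambda>_. {1..2}" d] cd(1,2) C unfolding words_def by blast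
  qed
  have S_x: "S x = {}"
    unfolding S_def by simp
  interpret golay_parameters "{1..24}" "S ` C" "S y"
  proof
    show "S ` C \<subseteq> Pow {1..24}"
      unfolding S_def by auto
    show "{} \<in> S ` C"
      using S_x x by (metis image_eqI)
    show "card (S ` C) = 4096"
      using card_image[OF inj] C by simp
    show "card (sym_diff u v) \<in> {0, 8, 12, 16, 24}" if "u \<in> S ` C" "v \<in> S ` C" for u v
    proof -
      obtain c d where cd: "c \<in> C" "d \<in> C" "u = S c" "v = S d"
        using \<open>u \<in> S ` C\<close> \<open>v \<in> S ` C\<close> by blast
      then show ?thesis
        using dist[OF cd(1,2)] S_diff[OF cd(1,2)] unfolding hamming_dist_def by simp
    qed
    show "S y \<in> S ` C"
      using y by blast
    have "S y = {i \<in> {1..24}. x i \<noteq> y i}"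
      unfolding S_def by auto
    then show "card (S y) = 12"
      using y(2) unfolding hamming_dist_def by simp
  qed simp
  obtain vs where vs: "distinct vs" "set vs = {1..24}" "length vs = 24"
    and golay: "\<And>c. c \<in> S ` C \<Longrightarrow> golay_word {j. j < 24 \<and> vs ! j \<in> c} \<in> extended_golay"
    using golay_labelling by blast
  \<comment> \<open>Coordinate \<open>i\<close> of the Golay code has label
    \<open>golay_positions ! (i - 1)\<close>, with \<open>i - 1\<close> since lists start at 0;
    \<open>vs\<close> sends that label to a coordinate of \<open>C\<close>.\<close>
  define \<pi> where "\<pi> = (\<lambda>i. if i \<in> {1..24} then vs ! (golay_positions ! (i - 1)) else i)"
  have position: "golay_positions ! (i - 1) < 24" if "i \<in> {1..24}" for i
  proof -
    have "golay_positions ! (i - 1) \<in> set golay_positions"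
      using that by (intro nth_mem) (auto simp: length_golay_positions)
    then show ?thesis
      unfolding set_golay_positions by simp
  qed
  have \<pi>_mem: "\<pi> i \<in> {1..24}" if "i \<in> {1..24}" for i
    using nth_mem[of "golay_positions ! (i - 1)" vs] position[OF that] that vs unfolding \<pi>_def by simp
  have "\<pi> permutes {1..24}"
  proof (rule bij_imp_permutes)
    have "{1..24} \<subseteq> \<pi> ` {1..24}"
    proof
      fix u :: nat assume "u \<in> {1..24}"
      then obtain j where j: "j < 24" "u = vs ! j"
        using vs by (metis in_set_conv_nth)
      then obtain k where k: "k < 24" "j = golay_positions ! k"
        using set_golay_positions length_golay_positions by (metis in_set_conv_nth lessThan_iff)
      then have "u = \<pi> (Suc k)" "Suc k \<in> {1..24}"
        using j unfolding \<pi>_def by auto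
      then show "u \<in> \<pi> ` {1..24}"
        by blast
    qed
    then have "\<pi> ` {1..24} = {1..24}"
      using \<pi>_mem by blast
    then show "bij_betw \<pi> {1..24} {1..24}"
      unfolding bij_betw_def using eq_card_imp_inj_on[of "{1..24}" \<pi>] by simp
  qed (simp only: \<pi>_def if_False)
  then show ?thesis
  proof (rule binary_code_isomorphicI[OF C(1) x _ _ finite_extended_golay])
    show "card extended_golay \<le> card C"
      using card_extended_golay_le C by simp
    fix c assume c: "c \<in> C"
    have "golay_word {j. j < 24 \<and> vs ! j \<in> S c} = (\<lambda>i\<in>{1..24}. if c (\<pi> i) = x (\<pi> i) then 0 else 1)"
      unfolding golay_word_def
    proof (rule restrict_ext)
      fix i :: nat assume i: "i \<in> {1..24}"
      then have "vs ! (golay_positions ! (i - 1)) = \<pi> i"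
        unfolding \<pi>_def by simp
      then have "golay_positions ! (i - 1) \<in> {j. j < 24 \<and> vs ! j \<in> S c} \<longleftrightarrow> c (\<pi> i) \<noteq> x (\<pi> i)"
        using position[OF i] \<pi>_mem[OF i] unfolding S_def by simp
      then show "(if golay_positions ! (i - 1) \<in> {j. j < 24 \<and> vs ! j \<in> S c} then 1 else 0)
          = (if c (\<pi> i) = x (\<pi> i) then 0 else (1 :: bit))"
        by (simp only: if_not_P if_P split: if_split) blast
    qed
    then show "(\<lambda>i\<in>{1..24}. if c (\<pi> i) = x (\<pi> i) then 0 else 1) \<in> extended_golay"
      using golay c by (metis image_eqI)
  qed
qed

theorem theorem4p13:
  fixes n q :: nat and C :: "(nat \<Rightarrow> nat) set" and a :: int
  assumes "even n" and "n \<ge> 8" and "q \<ge> 2"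
    and "hamming_design 7 n q C"
    and "code_degree n C = 4"
    and "a < int n div 2"
    and "int ` degree_set n C = {a, int n div 2, int n - a, int n}"
  shows "n = 8 \<and> q = 2 \<and> code_isomorphic 8 2 C (of_binary 8 (binary_dual 8 (binary_repetition 8)))
       \<or> n = 24 \<and> q = 2 \<and> code_isomorphic 24 2 C (of_binary 24 extended_golay)"
proof -
  note parameters = design_parameters[OF assms(1-4,6,7)]
  have q: "q = 2"
    using parameters by blast
  have distance: "int (hamming_dist n x y) \<in> {0, a, int n div 2, int n - a, int n}" if "x \<in> C" "y \<in> C" for x y
  proof (cases "x = y")
    case False
    then have "hamming_dist n x y \<in> degree_set n C"
      using that unfolding degree_set_def by blast
    then show ?thesis
      using assms(7) by blast
  qed (simp add: hamming_dist_def)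
  from parameters(2) show ?thesis
  proof (elim disjE conjE)
    assume n: "n = 8" and a: "a = 2"
    have "code_isomorphic 8 2 C (of_binary 8 (binary_dual 8 (binary_repetition 8)))"
    proof (rule even_distances_isomorphic)
      show "hamming_design (8 - 1) 8 2 C"
        using assms(4) n q by simp
      show "even (hamming_dist 8 x y)" if "x \<in> C" "y \<in> C" for x y
        using distance[OF that] n a by auto
    qed simp
    then show ?thesis
      using n q by blast
  next
    assume n: "n = 24" and a: "a = 8" and card: "card C = 4096"
    \<comment> \<open>The middle distance \<open>n / 2\<close> is attained, which supplies the
      dodecad.\<close>
    have "12 \<in> {a, int n div 2, int n - a, int n}"
      using n by simp
    then have "12 \<in> int ` degree_set n C"
      unfolding assms(7) .
    then obtain x y where xy: "x \<in> C" "y \<in> C" "hamming_dist 24 x y = 12"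
      unfolding degree_set_def n by auto
    have "code_isomorphic 24 2 C (of_binary 24 extended_golay)"
    proof (rule golay_code_isomorphic[OF _ card _ xy])
      show "C \<subseteq> words 24 2"
        using assms(4) n q unfolding hamming_design_def by blast
      show "hamming_dist 24 c d \<in> {0, 8, 12, 16, 24}" if "c \<in> C" "d \<in> C" for c d
        using distance[OF that] n a by auto
    qed
    then show ?thesis
      using n q by blast
  qed
qed

end
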